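(* Let $(X,\Sigma,\mathfrak m)$ be a $\sigma$-finite measure space, let $\mathbb B$ be a separable Banach space and let $\mathbf E$ be a Banach $\mathbb B$-bundle over $X$. Then $\mathbf E$ is a Hilbert bundle (i.e. $\mathbf E(x)$ is Hilbert for $\mathfrak m$-a.e. $x\in X$) if and only if $\Gamma_2(\mathbf E)$ is a Hilbert space. Moreover, the implication "$\mathbf E$ Hilbert bundle $\Rightarrow$ $\Gamma_2(\mathbf E)$ Hilbert space" holds also when the Banach space $\mathbb B$ is non-separable.
   Context: All Banach spaces are real. A Banach space is called Hilbert if its norm is induced by a scalar product (equivalently, satisfies the parallelogram identity). Banach bundles: given a measurable space $(X,\Sigma)$ and a Banach space $\mathbb B$, a multivalued map $\mathbf E$ from $X$ to $\mathbb B$ (a map from $X$ to the power set of $\mathbb B$) is weakly measurable if $\{x\in X:\mathbf E(x)\cap U\neq\varnothing\}\in\Sigma$ for every open set $U\subseteq\mathbb B$. A Banach $\mathbb B$-bundle over $X$ is a weakly measurable multivalued map $\mathbf E$ such that $\mathbf E(x)$ is a closed linear subspace of $\mathbb B$ for every $x\in X$; $\mathbf E(x)$ carries the norm of $\mathbb B$. Sections: a map $v:X\to\mathbb B$ is strongly measurable if $x\mapsto\langle\omega,v(x)\rangle$ is measurable for every $\omega\in\mathbb B'$ (the continuous dual) and there is an $\mathfrak m$-null set $N\in\Sigma$ such that $v(X\setminus N)$ is separable. A section of $\mathbf E$ is a strongly measurable map $v:X\to\mathbb B$ with $v(x)\in\mathbf E(x)$ for every $x\in X$. For $p\in(1,\infty)$,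 $\Gamma_p(\mathbf E)$ is the space of equivalence classes, up to $\mathfrak m$-a.e. equality, of sections $v$ of $\mathbf E$ with $\|v(\cdot)\|_{\mathbb B}\in L^p(\mathfrak m)$. With pointwise operations and the norm $\|v\|_{\Gamma_p(\mathbf E)}=\big(\int\|v(x)\|_{\mathbb B}^p\,d\mathfrak m(x)\big)^{1/p}$ it is a Banach space. *)

theory Defs
  imports "HOL-Analysis.Analysis"
begin

section \<open>Real Banach and Hilbert spaces with an explicit carrier\<close>

text \<open>
  The fibres of a bundle and the spaces of sections depend on terms, so they cannot be instances
  of the type classes of normed spaces.
\<close>

record 'v normed_structure =
  carr :: "'v set"
  add :: "'v \<Rightarrow> 'v \<Rightarrow> 'v"
  zero :: "'v"
  scale :: "real \<Rightarrow> 'v \<Rightarrow> 'v"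
  nrm :: "'v \<Rightarrow> real"

locale normed_space_on =
  fixes V :: "'v normed_structure"
  assumes add_closed: "\<lbrakk>u \<in> carr V; v \<in> carr V\<rbrakk> \<Longrightarrow> add V u v \<in> carr V"
    and zero_closed: "zero V \<in> carr V"
    and scale_closed: "u \<in> carr V \<Longrightarrow> scale V c u \<in> carr V"
    and add_assoc: "\<lbrakk>u \<in> carr V; v \<in> carr V; w \<in> carr V\<rbrakk>
        \<Longrightarrow> add V (add V u v) w = add V u (add V v w)"
    and add_commute: "\<lbrakk>u \<in> carr V; v \<in> carr V\<rbrakk> \<Longrightarrow> add V u v = add V v u"
    and add_zero: "u \<in> carr V \<Longrightarrow> add V u (zero V) = u"
    and add_neg: "u \<in> carr V \<Longrightarrow> add V u (scale V (-1) u) = zero V"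
    and scale_one: "u \<in> carr V \<Longrightarrow> scale V 1 u = u"
    and scale_scale: "u \<in> carr V \<Longrightarrow> scale V c (scale V d u) = scale V (c * d) u"
    and scale_add: "\<lbrakk>u \<in> carr V; v \<in> carr V\<rbrakk>
        \<Longrightarrow> scale V c (add V u v) = add V (scale V c u) (scale V c v)"
    and add_scale: "u \<in> carr V \<Longrightarrow> scale V (c + d) u = add V (scale V c u) (scale V d u)"
    and nrm_nonneg: "u \<in> carr V \<Longrightarrow> 0 \<le> nrm V u"
    and nrm_eq_0_iff: "u \<in> carr V \<Longrightarrow> nrm V u = 0 \<longleftrightarrow> u = zero V"
    and nrm_scale: "u \<in> carr V \<Longrightarrow> nrm V (scale V c u) = \<bar>c\<bar> * nrm V u"
    and nrm_triangle: "\<lbrakk>u \<in> carr V; v \<in> carr V\<rbrakk> \<Longrightarrow> nrm V (add V u v) \<le> nrm V u + nrm V v"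

text \<open>
  The value 0 off the carrier is irrelevant; it is there because the library's locale of metric
  spaces requires non-negativity and symmetry of the distance on the whole type.
\<close>

definition dist_on :: "'v normed_structure \<Rightarrow> 'v \<Rightarrow> 'v \<Rightarrow> real" where
  "dist_on V u v =
     (if u \<in> carr V \<and> v \<in> carr V then nrm V (add V u (scale V (-1) v)) else 0)"

definition banach_space_on :: "'v normed_structure \<Rightarrow> bool" where
  "banach_space_on V \<longleftrightarrow>
     normed_space_on V \<and> Metric_space.mcomplete (carr V) (dist_on V)"

definition scalar_product_on :: "'v normed_structure \<Rightarrow> ('v \<Rightarrow> 'v \<Rightarrow> real) \<Rightarrow> bool" where
  "scalar_product_on V ip \<longleftrightarrow>
     (\<forall>u\<in>carr V. \<forall>v\<in>carr V. ip u v = ip v u) \<and>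
     (\<forall>u\<in>carr V. \<forall>v\<in>carr V. \<forall>w\<in>carr V. ip (add V u v) w = ip u w + ip v w) \<and>
     (\<forall>u\<in>carr V. \<forall>v\<in>carr V. \<forall>c. ip (scale V c u) v = c * ip u v) \<and>
     (\<forall>u\<in>carr V. 0 \<le> ip u u) \<and>
     (\<forall>u\<in>carr V. ip u u = 0 \<longleftrightarrow> u = zero V)"

definition hilbert_space_on :: "'v normed_structure \<Rightarrow> bool" where
  "hilbert_space_on V \<longleftrightarrow>
     banach_space_on V \<and>
     (\<exists>ip. scalar_product_on V ip \<and> (\<forall>u\<in>carr V. nrm V u = sqrt (ip u u)))"

definition subspace_structure :: "'b::real_normed_vector set \<Rightarrow> 'b normed_structure" where
  "subspace_structure S = \<lparr>carr = S, add = (+), zero = 0, scale = (*\<^sub>R), nrm = norm\<rparr>"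


section \<open>Banach bundles\<close>

definition weakly_measurable ::
    "'a measure \<Rightarrow> ('a \<Rightarrow> 'b::topological_space set) \<Rightarrow> bool" where
  "weakly_measurable M E \<longleftrightarrow> (\<forall>U. open U \<longrightarrow> {x \<in> space M. E x \<inter> U \<noteq> {}} \<in> sets M)"

definition banach_bundle :: "'a measure \<Rightarrow> ('a \<Rightarrow> 'b::banach set) \<Rightarrow> bool" where
  "banach_bundle M E \<longleftrightarrow>
     weakly_measurable M E \<and> (\<forall>x\<in>space M. subspace (E x) \<and> closed (E x))"

definition hilbert_bundle :: "'a measure \<Rightarrow> ('a \<Rightarrow> 'b::banach set) \<Rightarrow> bool" where
  "hilbert_bundle M E \<longleftrightarrow> (AE x in M. hilbert_space_on (subspace_structure (E x)))"


section \<open>Sections\<close>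

definition strongly_measurable :: "'a measure \<Rightarrow> ('a \<Rightarrow> 'b::banach) \<Rightarrow> bool" where
  "strongly_measurable M v \<longleftrightarrow>
     (\<forall>\<omega>::'b \<Rightarrow> real. bounded_linear \<omega> \<longrightarrow> (\<lambda>x. \<omega> (v x)) \<in> borel_measurable M) \<and>
     (\<exists>N\<in>null_sets M. separable_space (top_of_set (v ` (space M - N))))"

definition bundle_section :: "'a measure \<Rightarrow> ('a \<Rightarrow> 'b::banach set) \<Rightarrow> ('a \<Rightarrow> 'b) \<Rightarrow> bool" where
  "bundle_section M E v \<longleftrightarrow> strongly_measurable M v \<and> (\<forall>x\<in>space M. v x \<in> E x)"

text \<open>
  A strongly measurable map need not have a measurable pointwise norm: its norm is only almost
  everywhere equal to a measurable function. The non-negative integral does not depend on the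
  values on a null set, so its finiteness expresses that the norm is in \<open>L\<^sup>p\<close>
  without a separate measurability requirement.
\<close>

definition norm_powr_integral :: "real \<Rightarrow> 'a measure \<Rightarrow> ('a \<Rightarrow> 'b::banach) \<Rightarrow> ennreal" where
  "norm_powr_integral p M v = (\<integral>\<^sup>+x. ennreal (norm (v x) powr p) \<partial>M)"

definition p_sections ::
    "real \<Rightarrow> 'a measure \<Rightarrow> ('a \<Rightarrow> 'b::banach set) \<Rightarrow> ('a \<Rightarrow> 'b) set" where
  "p_sections p M E = {v. bundle_section M E v \<and> norm_powr_integral p M v < \<infinity>}"

text \<open>
  Sections are total functions whose values off the underlying space are arbitrary; the relation
  of almost everywhere equality ignores those values.
\<close>

definition ae_eq ::
    "real \<Rightarrow> 'a measure \<Rightarrow> ('a \<Rightarrow> 'b::banach set) \<Rightarrow> ('a \<Rightarrow> 'b) rel" where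
  "ae_eq p M E =
     {(v, w). v \<in> p_sections p M E \<and> w \<in> p_sections p M E \<and> (AE x in M. v x = w x)}"

definition section_space ::
    "real \<Rightarrow> 'a measure \<Rightarrow> ('a \<Rightarrow> 'b::banach set) \<Rightarrow> ('a \<Rightarrow> 'b) set normed_structure" where
  "section_space p M E =
     \<lparr>carr = p_sections p M E // ae_eq p M E,
      add = (\<lambda>f g. \<Union>v\<in>f. \<Union>w\<in>g. ae_eq p M E `` {\<lambda>x. v x + w x}),
      zero = ae_eq p M E `` {\<lambda>x. 0},
      scale = (\<lambda>c f. \<Union>v\<in>f. ae_eq p M E `` {\<lambda>x. c *\<^sub>R v x}),
      nrm = (\<lambda>f. the_elem ((\<lambda>v. enn2real (norm_powr_integral p M v) powr (1 / p)) ` f))\<rparr>"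

end

theory Submission
  imports Defs
begin

text \<open>
  A norm comes from a scalar product if and only if its polarization
  \<open>(\<parallel>u + v\<parallel>\<^sup>2 - \<parallel>u - v\<parallel>\<^sup>2) / 4\<close> is linear in \<open>u\<close>, because the polarization is the only
  possible scalar product. Being Hilbert is thereby the vanishing of one continuous function, the
  polarization defect of a triple of vectors and a real number. In a fibre it has to vanish
  pointwise; in the space of square-integrable sections it has to vanish after integration, since
  the squared norm of a section is the integral of the squared norms of its values.

  If almost every fibre is Hilbert, the defect of three sections vanishes almost everywhere and so
  does its integral. Conversely, multiplying three sections by the indicator of a measurable set
  multiplies their defect by the same indicator. If all integrated defects vanish, the defect of
  any three sections therefore integrates to zero over every measurable set and is zero almost
  everywhere. When the ambient space is separable, the Kuratowski--Ryll-Nardzewski construction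
  gives countably many measurable selections that are dense in every fibre; \<open>\<sigma>\<close>-finiteness makes
  it possible to truncate them to square-integrable sections. Outside one null set the defect
  vanishes for all these sections and all rational scalars, and by continuity on the whole
  fibre.

  Both directions rest on the section space being a Banach space. Without separability of the
  ambient space, the measurability of the pointwise norm of a section is Pettis' argument: on the
  essential range, the norm is a supremum of countably many norming functionals, which the
  Hahn--Banach theorem provides. That norm agrees with a measurable function only almost
  everywhere, so the integrals are taken with respect to the completed measure. Completeness is
  the Riesz--Fischer argument.
\<close>

section \<open>Norming functionals\<close>

definition sublinear :: "('a::real_vector \<Rightarrow> real) \<Rightarrow> bool" where
  "sublinear p \<longleftrightarrow> (\<forall>x y. p (x + y) \<le> p x + p y) \<and> (\<forall>t\<ge>0. \<forall>x. p (t *\<^sub>R x) \<le> t * p x)"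

lemma sublinear_add: "sublinear p \<Longrightarrow> p (x + y) \<le> p x + p y"
  by (simp add: sublinear_def)

lemma sublinear_scale:
  assumes "sublinear p" "0 \<le> t"
  shows "p (t *\<^sub>R x) = t * p x"
proof (cases "t = 0")
  case True
  have "p 0 \<le> 0" using assms(1) unfolding sublinear_def by (metis mult_zero_left order_refl scaleR_zero_left)
  moreover have "p 0 \<le> p 0 + p 0" using sublinear_add[OF assms(1), of 0 0] by simp
  ultimately show ?thesis using True by simp
next
  case False
  have "p ((1/t) *\<^sub>R (t *\<^sub>R x)) \<le> (1/t) * p (t *\<^sub>R x)"
    using assms unfolding sublinear_def by (metis zero_le_divide_1_iff)
  hence "t * p x \<le> p (t *\<^sub>R x)" using False assms(2) by (simp add: field_simps)
  moreover have "p (t *\<^sub>R x) \<le> t * p x" using assms unfolding sublinear_def by blast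
  ultimately show ?thesis by simp
qed

lemma sublinear_zero: "sublinear p \<Longrightarrow> p 0 = 0"
  using sublinear_scale[of p 0 0] by simp

lemma sublinear_ge_neg: "sublinear p \<Longrightarrow> - p (- x) \<le> p x"
  using sublinear_add[of p x "- x"] sublinear_zero[of p] by simp

lemma sublinear_norm: "sublinear norm"
  by (simp add: sublinear_def norm_triangle_ineq)

text \<open>
  The device that pushes a sublinear functional down in the direction \<open>a\<close>. The value \<open>t = 0\<close> shows
  that the result lies below \<open>p\<close>, and \<open>t = 1\<close> at \<open>- a\<close> shows that it is at most \<open>- p a\<close> there.
\<close>

definition sublinear_descent :: "('a::real_vector \<Rightarrow> real) \<Rightarrow> 'a \<Rightarrow> 'a \<Rightarrow> real" where
  "sublinear_descent p a y = (INF t\<in>{0..}. p (y + t *\<^sub>R a) - t * p a)"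

lemma sublinear_descent_le:
  assumes "sublinear p" "0 \<le> t"
  shows "sublinear_descent p a y \<le> p (y + t *\<^sub>R a) - t * p a"
  unfolding sublinear_descent_def
proof (rule cINF_lower)
  have "- p (- y) \<le> p (y + s *\<^sub>R a) - s * p a" if "0 \<le> s" for s
    using sublinear_add[OF assms(1), of "y + s *\<^sub>R a" "- y"] sublinear_scale[OF assms(1) that, of a]
    by simp
  thus "bdd_below ((\<lambda>t. p (y + t *\<^sub>R a) - t * p a) ` {0..})" by (intro bdd_belowI2) auto
qed (use assms in auto)

lemma sublinear_descent_greatest:
  assumes "\<And>t. 0 \<le> t \<Longrightarrow> c \<le> p (y + t *\<^sub>R a) - t * p a"
  shows "c \<le> sublinear_descent p a y"
  unfolding sublinear_descent_def by (rule cINF_greatest) (use assms in auto)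

lemma sublinear_sublinear_descent:
  assumes p: "sublinear p"
  shows "sublinear (sublinear_descent p a)"
  unfolding sublinear_def
proof (intro conjI allI impI)
  let ?q = "sublinear_descent p a"
  fix x y
  have "?q (x + y) - (p (y + s *\<^sub>R a) - s * p a) \<le> p (x + t *\<^sub>R a) - t * p a" if "0 \<le> s" "0 \<le> t" for s t
    using sublinear_descent_le[OF p, of "t + s" a "x + y"] that
      sublinear_add[OF p, of "x + t *\<^sub>R a" "y + s *\<^sub>R a"]
    by (simp add: algebra_simps)
  hence "?q (x + y) - (p (y + s *\<^sub>R a) - s * p a) \<le> ?q x" if "0 \<le> s" for s
    using that by (intro sublinear_descent_greatest) auto
  hence "?q (x + y) - ?q x \<le> ?q y"
    by (intro sublinear_descent_greatest) (simp add: algebra_simps)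
  thus "?q (x + y) \<le> ?q x + ?q y" by simp
next
  let ?q = "sublinear_descent p a"
  fix c :: real and x assume c: "0 \<le> c"
  show "?q (c *\<^sub>R x) \<le> c * ?q x"
  proof (cases "c = 0")
    case True
    thus ?thesis using sublinear_descent_le[OF p, of 0 a 0] sublinear_zero[OF p] by simp
  next
    case False
    have "?q (c *\<^sub>R x) / c \<le> p (x + t *\<^sub>R a) - t * p a" if "0 \<le> t" for t
      using sublinear_descent_le[OF p, of "c * t" a "c *\<^sub>R x"] that c False
        sublinear_scale[OF p c, of "x + t *\<^sub>R a"]
      by (simp add: field_simps scaleR_add_right)
    hence "?q (c *\<^sub>R x) / c \<le> ?q x" by (rule sublinear_descent_greatest)
    thus ?thesis using c False by (simp add: field_simps)
  qed
qed

text \<open>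
  The descent of a minimal functional in any direction is the functional itself, and comparison with
  the term \<open>t = 1\<close> of the infimum turns subadditivity into additivity.
\<close>

lemma minimal_sublinear_imp_linear:
  assumes p: "sublinear p" and min: "\<And>q. sublinear q \<Longrightarrow> q \<le> p \<Longrightarrow> q = p"
  shows "linear p"
proof -
  have "sublinear_descent p a = p" for a
    using sublinear_descent_le[OF p, of 0 a] by (intro min sublinear_sublinear_descent p) (simp add: le_fun_def)
  hence "p y \<le> p (y + a) - p a" for y a
    using sublinear_descent_le[OF p, of 1 a y] by simp
  hence add: "p (y + a) = p y + p a" for y a
    using sublinear_add[OF p, of y a] by (smt (verit))
  have neg: "p (- y) = - p y" for y
    using add[of y "- y"] sublinear_zero[OF p] by simp
  have "p (c *\<^sub>R y) = c * p y" for c y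
    using sublinear_scale[OF p, of c y] sublinear_scale[OF p, of "- c" y] neg[of "c *\<^sub>R y"]
    by (cases "0 \<le> c") auto
  thus ?thesis by (intro linearI) (auto simp: add)
qed

text \<open>
  Zorn's lemma gives a minimal sublinear functional below \<open>q\<close>. The infimum of a chain is subadditive
  because, of two members of the chain, the smaller one bounds both values; it is finite because
  every member lies above \<open>\<lambda>y. - q (- y)\<close>.
\<close>

theorem Hahn_Banach_sublinear:
  assumes q: "sublinear q"
  obtains f where "linear f" "f \<le> q"
proof -
  define A where "A = {p. sublinear p \<and> p \<le> q}"
  have "\<exists>m\<in>A. \<forall>p\<in>A. p \<le> m \<longrightarrow> p = m"
  proof (rule predicate_Zorn)
    show "partial_order_on A (relation_of (\<lambda>x y. y \<le> x) A)"
      by (rule partial_order_on_relation_ofI) auto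
  next
    fix C assume C: "C \<in> Chains (relation_of (\<lambda>x y. y \<le> x) A)"
    hence CA: "C \<subseteq> A" and chain: "\<And>p p'. p \<in> C \<Longrightarrow> p' \<in> C \<Longrightarrow> p \<le> p' \<or> p' \<le> p"
      by (auto simp: Chains_def relation_of_def)
    show "\<exists>u\<in>A. \<forall>p\<in>C. u \<le> p"
    proof (cases "C = {}")
      case True
      thus ?thesis using q by (auto simp: A_def)
    next
      case False
      define u where "u y = (INF p\<in>C. p y)" for y
      have "- q (- y) \<le> p y" if "p \<in> C" for p y
      proof -
        have "sublinear p" "p (- y) \<le> q (- y)" using that CA by (auto simp: A_def le_fun_def)
        thus ?thesis using sublinear_ge_neg[of p y] by linarith
      qed
      hence "bdd_below ((\<lambda>p. p y) ` C)" for y by (intro bdd_belowI2) auto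
      hence le: "u y \<le> p y" if "p \<in> C" for p y
        unfolding u_def by (intro cINF_lower that)
      have ge: "c \<le> u y" if "\<And>p. p \<in> C \<Longrightarrow> c \<le> p y" for c y
        unfolding u_def using that False by (intro cINF_greatest)
      have sub: "sublinear p" if "p \<in> C" for p using that CA by (auto simp: A_def)
      have "sublinear u" unfolding sublinear_def
      proof (intro conjI allI impI)
        fix x y
        have "u (x + y) - p' y \<le> p x" if "p \<in> C" "p' \<in> C" for p p'
          using chain[OF that]
        proof
          assume "p \<le> p'"
          thus ?thesis using le[OF that(1), of "x + y"] sublinear_add[OF sub[OF that(1)], of x y]
            by (auto simp: le_fun_def dest!: spec[of _ y])
        next
          assume "p' \<le> p"
          thus ?thesis using le[OF that(2), of "x + y"] sublinear_add[OF sub[OF that(2)], of x y]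
            by (auto simp: le_fun_def dest!: spec[of _ x])
        qed
        hence "u (x + y) - p' y \<le> u x" if "p' \<in> C" for p' using that by (intro ge)
        hence "u (x + y) - u x \<le> u y" by (intro ge) (simp add: algebra_simps)
        thus "u (x + y) \<le> u x + u y" by simp
      next
        fix c :: real and x assume c: "0 \<le> c"
        show "u (c *\<^sub>R x) \<le> c * u x"
        proof (cases "c = 0")
          case True
          thus ?thesis using False le sublinear_zero[OF sub] by (metis equals0I mult_zero_left scaleR_zero_left)
        next
          case nz: False
          have "u (c *\<^sub>R x) / c \<le> u x"
            using le[of _ "c *\<^sub>R x"] sublinear_scale[OF sub c] c nz by (intro ge) (simp add: field_simps)
          thus ?thesis using c nz by (simp add: field_simps)
        qed
      qed
      moreover have "u \<le> q"
      proof -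
        obtain p where "p \<in> C" using False by blast
        hence "u \<le> p" "p \<le> q" using le CA by (auto simp: A_def le_fun_def)
        thus ?thesis by (rule order_trans)
      qed
      ultimately show ?thesis using le by (auto simp: A_def le_fun_def)
    qed
  qed
  then obtain m where m: "sublinear m" "m \<le> q" "\<And>p. sublinear p \<Longrightarrow> p \<le> q \<Longrightarrow> p \<le> m \<Longrightarrow> p = m"
    by (auto simp: A_def)
  have "linear m" using m by (intro minimal_sublinear_imp_linear) auto
  thus ?thesis using m(2) by (rule that)
qed

text \<open>
  A linear functional below the descent of the norm in the direction \<open>x\<close> is at most \<open>- norm x\<close> at
  \<open>- x\<close>, and below the norm everywhere.
\<close>

corollary norming_functional:
  fixes x :: "'a::real_normed_vector"
  obtains f :: "'a \<Rightarrow> real" where "bounded_linear f" "\<And>y. \<bar>f y\<bar> \<le> norm y" "f x = norm x"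
proof -
  obtain f where f: "linear f" "f \<le> sublinear_descent norm x"
    using Hahn_Banach_sublinear[OF sublinear_sublinear_descent[OF sublinear_norm]] by blast
  have le: "f y \<le> norm y" for y
    using f(2) sublinear_descent_le[OF sublinear_norm, of 0 x y] by (auto simp: le_fun_def intro: order_trans)
  have neg: "f (- y) = - f y" for y using f(1) by (rule linear_neg)
  have abs: "\<bar>f y\<bar> \<le> norm y" for y using le[of y] le[of "- y"] neg[of y] by simp
  have "f (- x) \<le> - norm x"
    using f(2) sublinear_descent_le[OF sublinear_norm, of 1 x "- x"] by (auto simp: le_fun_def intro: order_trans)
  hence "f x = norm x" using le[of x] neg[of x] by simp
  moreover have "bounded_linear f"
    using f(1) abs by (intro bounded_linear_intro[where K=1]) (auto simp: linear_add linear_scale)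
  ultimately show ?thesis using abs by (intro that)
qed

section \<open>Strongly measurable maps\<close>

text \<open>
  Separability of a subset is replaced by containment in the closure of a countable set that need
  not lie in the subset. This form passes to subsets, sums and limits without a choice of new dense
  points.
\<close>

lemma separable_space_top_of_set_iff:
  fixes S :: "'a::metric_space set"
  shows "separable_space (top_of_set S) \<longleftrightarrow> (\<exists>D. countable D \<and> S \<subseteq> closure D)"
proof
  assume "separable_space (top_of_set S)"
  then obtain C where "countable C" "C \<subseteq> S" "top_of_set S closure_of C = S"
    unfolding separable_space_def by auto
  thus "\<exists>D. countable D \<and> S \<subseteq> closure D"
    by (metis closure_of_subtopology_subset euclidean_closure_of)
next
  assume "\<exists>D. countable D \<and> S \<subseteq> closure D"
  then obtain D where D: "countable D" "S \<subseteq> closure D" by blast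
  \<comment> \<open>the points of \<open>D\<close> are moved into \<open>S\<close> wherever \<open>S\<close> comes close enough\<close>
  define near where "near d n = (SOME s. s \<in> S \<and> dist d s < 1 / real (Suc n))" for d n
  define C where "C = (\<lambda>(d, n). near d n) ` {(d, n). d \<in> D \<and> (\<exists>s\<in>S. dist d s < 1 / real (Suc n))}"
  have near: "near d n \<in> S \<and> dist d (near d n) < 1 / real (Suc n)" if "\<exists>s\<in>S. dist d s < 1 / real (Suc n)" for d n
    using someI_ex[of "\<lambda>s. s \<in> S \<and> dist d s < 1 / real (Suc n)"] that unfolding near_def by blast
  have "countable (D \<times> (UNIV :: nat set))" using D(1) by simp
  hence "countable C" unfolding C_def by (intro countable_image) (rule countable_subset, auto)
  moreover have "C \<subseteq> S" using near by (auto simp: C_def)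
  moreover have "S \<subseteq> closure C"
  proof
    fix s assume s: "s \<in> S"
    show "s \<in> closure C" unfolding closure_approachable
    proof (intro allI impI)
      fix e :: real assume "0 < e"
      then obtain n where n: "1 / real (Suc n) < e / 2" using nat_approx_posE[of "e/2"] by auto
      obtain d where d: "d \<in> D" "dist d s < 1 / real (Suc n)"
        using s D(2) unfolding closure_approachable by (metis closure_approachable subsetD zero_less_divide_1_iff of_nat_0_less_iff zero_less_Suc)
      have "near d n \<in> C" using d s by (auto simp: C_def)
      moreover have "dist (near d n) s < e"
      proof -
        have "dist d (near d n) < 1 / real (Suc n)" using near[of d n] d s by blast
        thus ?thesis
          using d(2) n dist_triangle[of "near d n" s d] by (simp only: dist_commute[of "near d n" d])
      qed
      ultimately show "\<exists>y\<in>C. dist y s < e" by blast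
    qed
  qed
  ultimately show "separable_space (top_of_set S)"
    unfolding separable_space_def
    by (intro exI[of _ C]) (auto simp: closure_of_subtopology Int_absorb1)
qed

lemma strongly_measurable_iff:
  "strongly_measurable M v \<longleftrightarrow>
     (\<forall>\<omega>::'b::banach \<Rightarrow> real. bounded_linear \<omega> \<longrightarrow> (\<lambda>x. \<omega> (v x)) \<in> borel_measurable M) \<and>
     (\<exists>N\<in>null_sets M. \<exists>D. countable D \<and> v ` (space M - N) \<subseteq> closure D)"
  by (simp add: strongly_measurable_def separable_space_top_of_set_iff)

lemma strongly_measurableE:
  fixes v :: "'a \<Rightarrow> 'b::banach"
  assumes "strongly_measurable M v"
  obtains N D where "N \<in> null_sets M" "countable D" "\<And>x. x \<in> space M - N \<Longrightarrow> v x \<in> closure D"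
proof -
  from assms obtain N D where "N \<in> null_sets M" "countable D" "v ` (space M - N) \<subseteq> closure D"
    unfolding strongly_measurable_iff by auto
  thus ?thesis by (intro that[of N D]) auto
qed

lemma strongly_measurableD:
  "strongly_measurable M v \<Longrightarrow> bounded_linear \<omega> \<Longrightarrow> (\<lambda>x. \<omega> (v x) :: real) \<in> borel_measurable M"
  by (simp add: strongly_measurable_def)

lemma strongly_measurableI:
  assumes "\<And>\<omega>::'b::banach \<Rightarrow> real. bounded_linear \<omega> \<Longrightarrow> (\<lambda>x. \<omega> (v x)) \<in> borel_measurable M"
    and "N \<in> null_sets M" "countable D" "\<And>x. x \<in> space M \<Longrightarrow> x \<notin> N \<Longrightarrow> v x \<in> closure D"
  shows "strongly_measurable M v"
  using assms unfolding strongly_measurable_iff by (intro conjI bexI[of _ N] exI[of _ D]) auto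

lemma strongly_measurable_linear_combination:
  fixes v w :: "'a \<Rightarrow> 'b::banach"
  assumes v: "strongly_measurable M v" and w: "strongly_measurable M w"
    and f: "f \<in> borel_measurable M" and g: "g \<in> borel_measurable M"
  shows "strongly_measurable M (\<lambda>x. f x *\<^sub>R v x + g x *\<^sub>R w x)"
proof -
  obtain N D where N: "N \<in> null_sets M" "countable D" "\<And>x. x \<in> space M - N \<Longrightarrow> v x \<in> closure D"
    using strongly_measurableE[OF v] by blast
  obtain N' D' where N': "N' \<in> null_sets M" "countable D'" "\<And>x. x \<in> space M - N' \<Longrightarrow> w x \<in> closure D'"
    using strongly_measurableE[OF w] by blast
  \<comment> \<open>The combinations of points of \<open>D\<close> and \<open>D'\<close> with rational coefficients have almost all
    values of the map in their closure.\<close>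
  let ?h = "\<lambda>((c, u), (d, z)). c *\<^sub>R u + d *\<^sub>R z :: 'b"
  let ?D = "((\<rat> :: real set) \<times> D) \<times> ((\<rat> :: real set) \<times> D')"
  show ?thesis
  proof (rule strongly_measurableI)
    fix \<omega> :: "'b \<Rightarrow> real" assume \<omega>: "bounded_linear \<omega>"
    interpret \<omega>: bounded_linear \<omega> by fact
    show "(\<lambda>x. \<omega> (f x *\<^sub>R v x + g x *\<^sub>R w x)) \<in> borel_measurable M"
      using strongly_measurableD[OF v \<omega>] strongly_measurableD[OF w \<omega>] f g
      by (simp add: \<omega>.add \<omega>.scaleR)
  next
    show "N \<union> N' \<in> null_sets M" using N N' by auto
    show "countable (?h ` ?D)" using N N' by (intro countable_image countable_SIGMA countable_rat) auto
    fix x assume x: "x \<in> space M" "x \<notin> N \<union> N'"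
    have "((f x, v x), (g x, w x)) \<in> closure ?D"
      using x N(3) N'(3) by (auto simp: closure_Times Rats_closure_real)
    moreover have "?h ` closure ?D \<subseteq> closure (?h ` ?D)"
      by (rule image_closure_subset) (auto intro!: continuous_intros closure_subset simp: split_def)
    ultimately show "f x *\<^sub>R v x + g x *\<^sub>R w x \<in> closure (?h ` ?D)" by force
  qed
qed

lemma strongly_measurable_zero: "strongly_measurable M (\<lambda>x. 0)"
  by (rule strongly_measurableI[of _ _ "{}" "{0}"]) (auto simp: linear_simps)

lemma strongly_measurable_add:
  "strongly_measurable M v \<Longrightarrow> strongly_measurable M w \<Longrightarrow> strongly_measurable M (\<lambda>x. v x + w x)"
  using strongly_measurable_linear_combination[of M v w "\<lambda>_. 1" "\<lambda>_. 1"] by simp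

lemma strongly_measurable_scaleR:
  "strongly_measurable M v \<Longrightarrow> f \<in> borel_measurable M \<Longrightarrow> strongly_measurable M (\<lambda>x. f x *\<^sub>R v x)"
  using strongly_measurable_linear_combination[of M v v f "\<lambda>_. 0"] by simp

lemma borel_measurable_completion_AE_eq:
  fixes g :: "'a \<Rightarrow> real"
  assumes g: "g \<in> borel_measurable M" and ae: "AE x in M. f x = g x"
  shows "f \<in> borel_measurable (completion M)"
proof (rule measurableI)
  fix A :: "real set" assume A: "A \<in> sets borel"
  obtain N where N: "N \<in> null_sets M" "{x \<in> space M. f x \<noteq> g x} \<subseteq> N"
    using ae unfolding eventually_ae_filter by blast
  show "f -` A \<inter> space (completion M) \<in> sets (completion M)"
  proof (rule sets_completionI)
    show "f -` A \<inter> space (completion M)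
      = (g -` A \<inter> space M - N) \<union> (f -` A \<inter> space M \<inter> N)"
      using N(2) by auto
    show "g -` A \<inter> space M - N \<in> sets M"
      using measurable_sets[OF g A] N(1) by auto
  qed (use N(1) in auto)
qed auto

text \<open>
  Pettis' argument. If \<open>d\<close> is close to \<open>v x\<close>, the functional that norms \<open>d\<close> almost norms \<open>v x\<close>.
  So the functionals norming a countable set whose closure contains almost all values of \<open>v\<close> have
  \<open>norm (v x)\<close> as their supremum for almost every \<open>x\<close>.
\<close>

lemma borel_measurable_norm_completion:
  assumes v: "strongly_measurable M v"
  shows "(\<lambda>x. norm (v x)) \<in> borel_measurable (completion M)"
proof -
  obtain N D where N: "N \<in> null_sets M" "countable D" "\<And>x. x \<in> space M - N \<Longrightarrow> v x \<in> closure D"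
    using strongly_measurableE[OF v] by blast
  have "\<forall>d::'b. \<exists>f :: 'b \<Rightarrow> real. bounded_linear f \<and> (\<forall>y. \<bar>f y\<bar> \<le> norm y) \<and> f d = norm d"
    by (meson norming_functional)
  then obtain \<omega> :: "'b \<Rightarrow> 'b \<Rightarrow> real" where \<omega>:
    "\<And>d. bounded_linear (\<omega> d)" "\<And>d y. \<bar>\<omega> d y\<bar> \<le> norm y" "\<And>d. \<omega> d d = norm d"
    by metis
  \<comment> \<open>The point 0 is added to have a nonempty index set when \<open>D\<close> is empty.\<close>
  define g where "g x = (SUP d\<in>insert 0 D. \<omega> d (v x))" for x
  have bdd: "bdd_above ((\<lambda>d. \<omega> d y) ` D')" for y D'
    using \<omega>(2)[of _ y] by (intro bdd_aboveI2[of _ _ "norm y"]) (meson abs_le_D1)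
  have g: "g \<in> borel_measurable M"
    unfolding g_def using N(2) strongly_measurableD[OF v \<omega>(1)] by (intro borel_measurable_cSUP bdd) auto
  have "norm (v x) = g x" if x: "x \<in> space M - N" for x
  proof (rule antisym)
    show "g x \<le> norm (v x)"
      unfolding g_def using \<omega>(2)[of _ "v x"] by (intro cSUP_least) (auto simp: abs_le_iff)
    show "norm (v x) \<le> g x"
    proof (rule field_le_epsilon)
      fix e :: real assume "0 < e"
      then obtain d where d: "d \<in> D" "dist d (v x) < e / 2"
        using N(3)[OF x] unfolding closure_approachable by (metis half_gt_zero)
      have "norm (v x) \<le> norm d + e / 2"
        using d(2) norm_triangle_ineq2[of "v x" d] by (simp add: dist_norm norm_minus_commute)
      also have "norm d = \<omega> d (v x) + \<omega> d (d - v x)"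
        using \<omega>(1,3)[of d] by (simp add: linear_simps)
      also have "\<omega> d (d - v x) \<le> e / 2" using \<omega>(2)[of d "d - v x"] d(2) by (simp add: dist_norm)
      also have "\<omega> d (v x) \<le> g x" unfolding g_def using d(1) by (intro cSUP_upper bdd) auto
      finally show "norm (v x) \<le> g x + e" by simp
    qed
  qed
  hence "AE x in M. norm (v x) = g x" using N(1) by (intro AE_I'[of N]) auto
  thus ?thesis using g by (rule borel_measurable_completion_AE_eq[rotated])
qed

section \<open>Scalar products as polarizations of norms\<close>

context normed_space_on
begin

lemma zero_add: "u \<in> carr V \<Longrightarrow> add V (zero V) u = u"
  by (metis add_commute add_zero zero_closed)

lemma nrm_zero: "nrm V (zero V) = 0"
  using nrm_eq_0_iff[OF zero_closed] by simp

lemma neg_neg: "u \<in> carr V \<Longrightarrow> scale V (-1) (scale V (-1) u) = u"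
  by (simp add: scale_scale scale_one)

lemma nrm_minus_commute:
  assumes "u \<in> carr V" "v \<in> carr V"
  shows "nrm V (add V u (scale V (-1) v)) = nrm V (add V v (scale V (-1) u))"
proof -
  have "scale V (-1) (add V v (scale V (-1) u)) = add V u (scale V (-1) v)"
    using assms by (metis add_commute neg_neg scale_add scale_closed)
  thus ?thesis
    using nrm_scale[of "add V v (scale V (-1) u)" "-1"] assms by (simp add: add_closed scale_closed)
qed

lemma diff_add_diff:
  assumes "u \<in> carr V" "v \<in> carr V" "w \<in> carr V"
  shows "add V (add V u (scale V (-1) v)) (add V v (scale V (-1) w)) = add V u (scale V (-1) w)"
proof -
  have "add V (scale V (-1) v) (add V v (scale V (-1) w)) = scale V (-1) w"
    using assms by (metis add_assoc add_commute add_neg scale_closed zero_add)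
  thus ?thesis using assms by (simp add: add_assoc add_closed scale_closed)
qed

lemma Metric_space_dist_on: "Metric_space (carr V) (dist_on V)"
proof
  fix x y z
  show "0 \<le> dist_on V x y" by (simp add: dist_on_def nrm_nonneg add_closed scale_closed)
  show "dist_on V x y = dist_on V y x" using nrm_minus_commute by (simp add: dist_on_def)
  assume xy: "x \<in> carr V" "y \<in> carr V"
  have "x = y" if "add V x (scale V (-1) y) = zero V"
    using xy that by (metis add_assoc add_commute add_neg add_zero scale_closed)
  thus "dist_on V x y = 0 \<longleftrightarrow> x = y"
    using xy nrm_eq_0_iff by (auto simp: dist_on_def add_closed scale_closed add_neg)
  assume z: "z \<in> carr V"
  show "dist_on V x z \<le> dist_on V x y + dist_on V y z"
    using xy z nrm_triangle[of "add V x (scale V (-1) y)" "add V y (scale V (-1) z)"]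
    by (simp add: dist_on_def diff_add_diff add_closed scale_closed)
qed

lemma banach_space_onI:
  assumes complete: "\<And>\<sigma> :: nat \<Rightarrow> 'v. \<lbrakk>\<And>n. \<sigma> n \<in> carr V;
      \<And>e. 0 < e \<Longrightarrow> \<exists>k. \<forall>m\<ge>k. \<forall>n\<ge>k. nrm V (add V (\<sigma> m) (scale V (-1) (\<sigma> n))) < e\<rbrakk>
    \<Longrightarrow> \<exists>l\<in>carr V. \<forall>e>0. \<exists>k. \<forall>n\<ge>k. nrm V (add V (\<sigma> n) (scale V (-1) l)) < e"
  shows "banach_space_on V"
proof -
  interpret MS: Metric_space "carr V" "dist_on V" by (rule Metric_space_dist_on)
  have "\<exists>l. limitin MS.mtopology \<sigma> l sequentially" if "MS.MCauchy \<sigma>" for \<sigma>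
  proof -
    have \<sigma>: "\<And>n. \<sigma> n \<in> carr V" using that by (auto simp: MS.MCauchy_def)
    have "\<exists>k. \<forall>m\<ge>k. \<forall>n\<ge>k. nrm V (add V (\<sigma> m) (scale V (-1) (\<sigma> n))) < e" if "0 < e" for e
      using \<open>MS.MCauchy \<sigma>\<close> that \<sigma> by (auto simp: MS.MCauchy_def dist_on_def)
    then obtain l where "l \<in> carr V" "\<forall>e>0. \<exists>k. \<forall>n\<ge>k. nrm V (add V (\<sigma> n) (scale V (-1) l)) < e"
      using complete[of \<sigma>] \<sigma> by blast
    thus ?thesis using \<sigma> by (auto simp: MS.limit_metric_sequentially dist_on_def)
  qed
  thus ?thesis
    using normed_space_on_axioms by (simp add: banach_space_on_def MS.mcomplete_def)
qed

end

text \<open>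
  The polarization identity recovers a scalar product from its norm, so this is the only candidate
  for a scalar product that induces the norm.
\<close>

definition polar :: "'v normed_structure \<Rightarrow> 'v \<Rightarrow> 'v \<Rightarrow> real" where
  "polar V u v = ((nrm V (add V u v))\<^sup>2 - (nrm V (add V u (scale V (-1) v)))\<^sup>2) / 4"

text \<open>
  A scalar product inducing the norm equals the polarization, by expanding both squares. Conversely,
  symmetry and positivity of the polarization hold in every normed space, since
  \<open>polar V u u = (nrm V u)\<^sup>2\<close>; only linearity in the first argument has to be required.
\<close>

lemma hilbert_space_on_iff_polar:
  "hilbert_space_on V \<longleftrightarrow> banach_space_on V \<and>
     (\<forall>c. \<forall>u\<in>carr V. \<forall>v\<in>carr V. \<forall>w\<in>carr V.
        polar V (add V (scale V c u) v) w = c * polar V u w + polar V v w)"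
proof (cases "banach_space_on V")
  case False
  thus ?thesis by (simp add: hilbert_space_on_def)
next
  case True
  then interpret normed_space_on V by (simp add: banach_space_on_def)
  show ?thesis
  proof (intro iffI conjI True)
    assume "hilbert_space_on V"
    then obtain ip where ip: "scalar_product_on V ip" and nrm: "\<And>u. u \<in> carr V \<Longrightarrow> nrm V u = sqrt (ip u u)"
      by (auto simp: hilbert_space_on_def)
    have sym: "ip u v = ip v u" if "u \<in> carr V" "v \<in> carr V" for u v
      using ip that by (simp add: scalar_product_on_def)
    have add: "ip (add V u v) w = ip u w + ip v w" if "u \<in> carr V" "v \<in> carr V" "w \<in> carr V" for u v w
      using ip that by (simp add: scalar_product_on_def)
    have scale: "ip (scale V c u) v = c * ip u v" if "u \<in> carr V" "v \<in> carr V" for c u v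
      using ip that by (simp add: scalar_product_on_def)
    have nrm2: "(nrm V u)\<^sup>2 = ip u u" if "u \<in> carr V" for u
      using ip that by (simp add: nrm scalar_product_on_def)
    have polar: "polar V u v = ip u v" if "u \<in> carr V" "v \<in> carr V" for u v
    proof -
      have "ip (add V u v') (add V u v') = ip u u + 2 * ip u v' + ip v' v'" if "v' \<in> carr V" for v'
        using that \<open>u \<in> carr V\<close> sym[of _ "add V u v'"] sym[of v' u] by (simp add: add add_closed)
      from this[of v] this[of "scale V (-1) v"] show ?thesis
        using that sym[of u "scale V (-1) v"] sym[of v "scale V (-1) v"] sym[of u v]
        by (simp add: polar_def nrm2 add_closed scale_closed scale)
    qed
    show "\<forall>c. \<forall>u\<in>carr V. \<forall>v\<in>carr V. \<forall>w\<in>carr V.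
        polar V (add V (scale V c u) v) w = c * polar V u w + polar V v w"
      by (auto simp: polar add scale add_closed scale_closed)
  next
    assume "banach_space_on V \<and> (\<forall>c. \<forall>u\<in>carr V. \<forall>v\<in>carr V. \<forall>w\<in>carr V.
        polar V (add V (scale V c u) v) w = c * polar V u w + polar V v w)"
    hence lin: "polar V (add V (scale V c u) v) w = c * polar V u w + polar V v w"
      if "u \<in> carr V" "v \<in> carr V" "w \<in> carr V" for c u v w using that by blast
    have diag: "polar V u u = (nrm V u)\<^sup>2" if "u \<in> carr V" for u
    proof -
      have "add V u u = scale V 2 u" using add_scale[OF that, of 1 1] scale_one[OF that] by simp
      thus ?thesis using that by (simp add: polar_def add_neg nrm_zero nrm_scale power2_eq_square)
    qed
    have zero: "polar V (zero V) w = 0" if "w \<in> carr V" for w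
      using that nrm_scale[of w "-1"] by (simp add: polar_def zero_add scale_closed)
    have "scalar_product_on V (polar V)"
      unfolding scalar_product_on_def
    proof (intro conjI ballI allI)
      fix u v w c assume u: "u \<in> carr V"
      show "0 \<le> polar V u u" using diag[OF u] by simp
      show "polar V u u = 0 \<longleftrightarrow> u = zero V" using diag[OF u] nrm_eq_0_iff[OF u] by simp
      assume v: "v \<in> carr V"
      show "polar V u v = polar V v u"
        using nrm_minus_commute[OF u v] add_commute[OF u v] by (simp add: polar_def)
      show "polar V (scale V c u) v = c * polar V u v"
        using lin[OF u zero_closed v, of c] u v zero by (simp add: add_zero scale_closed)
      assume w: "w \<in> carr V"
      show "polar V (add V u v) w = polar V u w + polar V v w"
        using lin[OF u v w, of 1] u by (simp add: scale_one)
    qed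
    moreover have "\<forall>u\<in>carr V. nrm V u = sqrt (polar V u u)"
      by (simp add: diag nrm_nonneg)
    ultimately show "hilbert_space_on V" using True by (auto simp: hilbert_space_on_def)
  qed
qed

lemma banach_space_on_subspace_structure:
  fixes S :: "'b::banach set"
  assumes S: "subspace S" "closed S"
  shows "banach_space_on (subspace_structure S)"
proof -
  interpret normed_space_on "subspace_structure S"
    using S by unfold_locales
      (auto simp: subspace_structure_def subspace_add subspace_0 subspace_scale algebra_simps norm_triangle_ineq)
  show ?thesis
  proof (rule banach_space_onI)
    fix \<sigma> :: "nat \<Rightarrow> 'b"
    assume \<sigma>: "\<And>n. \<sigma> n \<in> carr (subspace_structure S)"
      and Cauchy: "\<And>e. 0 < e \<Longrightarrow> \<exists>k. \<forall>m\<ge>k. \<forall>n\<ge>k.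
        nrm (subspace_structure S) (add (subspace_structure S) (\<sigma> m) (scale (subspace_structure S) (-1) (\<sigma> n))) < e"
    have "Cauchy \<sigma>"
      unfolding Cauchy_def using Cauchy by (simp add: subspace_structure_def dist_norm)
    then obtain l where l: "\<sigma> \<longlonglongrightarrow> l" using Cauchy_convergent by (auto simp: convergent_def)
    moreover have "l \<in> S"
      using closed_sequentially[OF S(2) _ l] \<sigma> by (simp add: subspace_structure_def)
    ultimately show "\<exists>l\<in>carr (subspace_structure S). \<forall>e>0. \<exists>k. \<forall>n\<ge>k.
        nrm (subspace_structure S) (add (subspace_structure S) (\<sigma> n) (scale (subspace_structure S) (-1) l)) < e"
      by (auto simp: subspace_structure_def lim_sequentially dist_norm)
  qed
qed

text \<open>
  The form \<open>polar\<close> of the ambient space, which all its subspaces share.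
\<close>

definition polarization :: "'b::real_normed_vector \<Rightarrow> 'b \<Rightarrow> real" where
  "polarization a b = ((norm (a + b))\<^sup>2 - (norm (a - b))\<^sup>2) / 4"

text \<open>
  The Hilbert property in the form of an equation: additivity and homogeneity are tested together, so
  that a single continuous function has to vanish.
\<close>

definition polarization_defect :: "real \<Rightarrow> 'b::real_normed_vector \<Rightarrow> 'b \<Rightarrow> 'b \<Rightarrow> real" where
  "polarization_defect c u v w =
     polarization (c *\<^sub>R u + v) w - (c * polarization u w + polarization v w)"

lemma hilbert_space_on_subspace_structure_iff:
  fixes S :: "'b::banach set"
  assumes "subspace S" "closed S"
  shows "hilbert_space_on (subspace_structure S) \<longleftrightarrow>
    (\<forall>c. \<forall>u\<in>S. \<forall>v\<in>S. \<forall>w\<in>S. polarization_defect c u v w = 0)"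
  using banach_space_on_subspace_structure[OF assms]
  unfolding hilbert_space_on_iff_polar
  by (simp add: polar_def subspace_structure_def polarization_def polarization_defect_def)

section \<open>Square-integrable sections\<close>

text \<open>
  In general the pointwise norm of a section is measurable only for the completed measure. Integrating with
  respect to the completion changes no non-negative integral and turns square-integrability into
  ordinary integrability.
\<close>

lemma p_sections_2_iff:
  "v \<in> p_sections 2 M E \<longleftrightarrow> strongly_measurable M v \<and> (\<forall>x\<in>space M. v x \<in> E x) \<and>
     integrable (completion M) (\<lambda>x. (norm (v x))\<^sup>2)"
proof (cases "strongly_measurable M v")
  case True
  have "norm_powr_integral 2 M v = (\<integral>\<^sup>+x. ennreal ((norm (v x))\<^sup>2) \<partial>completion M)"
    by (simp add: norm_powr_integral_def nn_integral_completion)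
  moreover have "(\<lambda>x. (norm (v x))\<^sup>2) \<in> borel_measurable (completion M)"
    using borel_measurable_norm_completion[OF True] by simp
  ultimately show ?thesis
    using True by (auto simp: p_sections_def bundle_section_def integrable_iff_bounded)
qed (simp add: p_sections_def bundle_section_def)

definition l2_norm :: "'a measure \<Rightarrow> ('a \<Rightarrow> 'b::banach) \<Rightarrow> real" where
  "l2_norm M v = sqrt (\<integral>x. (norm (v x))\<^sup>2 \<partial>completion M)"

lemma l2_norm_nonneg: "0 \<le> l2_norm M v"
  by (simp add: l2_norm_def)

lemma l2_norm_squared: "(l2_norm M v)\<^sup>2 = (\<integral>x. (norm (v x))\<^sup>2 \<partial>completion M)"
  by (simp add: l2_norm_def)

lemma integrable_norm_squared_add:
  fixes v w :: "'a \<Rightarrow> 'b::real_normed_vector"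
  assumes v: "integrable N (\<lambda>x. (norm (v x))\<^sup>2)" and w: "integrable N (\<lambda>x. (norm (w x))\<^sup>2)"
    and meas: "(\<lambda>x. norm (v x + w x)) \<in> borel_measurable N"
  shows "integrable N (\<lambda>x. (norm (v x + w x))\<^sup>2)"
proof (rule Bochner_Integration.integrable_bound)
  show "integrable N (\<lambda>x. 2 * (norm (v x))\<^sup>2 + 2 * (norm (w x))\<^sup>2)" using v w by simp
  have "(norm (v x + w x))\<^sup>2 \<le> 2 * (norm (v x))\<^sup>2 + 2 * (norm (w x))\<^sup>2" for x
  proof -
    have "(norm (v x + w x))\<^sup>2 \<le> (norm (v x) + norm (w x))\<^sup>2"
      by (intro power_mono norm_triangle_ineq) simp
    also have "\<dots> \<le> 2 * (norm (v x))\<^sup>2 + 2 * (norm (w x))\<^sup>2"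
      using sum_squares_bound[of "norm (v x)" "norm (w x)"] by (simp add: power2_sum)
    finally show ?thesis .
  qed
  thus "AE x in N. norm ((norm (v x + w x))\<^sup>2) \<le> norm (2 * (norm (v x))\<^sup>2 + 2 * (norm (w x))\<^sup>2)"
    by (intro AE_I2) (simp add: abs_of_nonneg)
qed (use meas in measurable)

text \<open>
  What makes the sections a Banach space: in subspaces the pointwise operations stay in the fibres, and
  closedness keeps almost everywhere limits there.
\<close>

locale closed_subspace_family =
  fixes M :: "'a measure" and E :: "'a \<Rightarrow> 'b::banach set"
  assumes subspace_fibre: "x \<in> space M \<Longrightarrow> subspace (E x)"
    and closed_fibre: "x \<in> space M \<Longrightarrow> closed (E x)"
begin

abbreviation L2 :: "('a \<Rightarrow> 'b) set" where "L2 \<equiv> p_sections 2 M E"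

lemma L2_strongly_measurable: "v \<in> L2 \<Longrightarrow> strongly_measurable M v"
  and L2_in_fibre: "v \<in> L2 \<Longrightarrow> x \<in> space M \<Longrightarrow> v x \<in> E x"
  and L2_integrable: "v \<in> L2 \<Longrightarrow> integrable (completion M) (\<lambda>x. (norm (v x))\<^sup>2)"
  by (simp_all add: p_sections_2_iff)

lemma L2_norm_measurable: "v \<in> L2 \<Longrightarrow> (\<lambda>x. norm (v x)) \<in> borel_measurable (completion M)"
  by (intro borel_measurable_norm_completion L2_strongly_measurable)

lemma L2_add:
  assumes "v \<in> L2" "w \<in> L2"
  shows "(\<lambda>x. v x + w x) \<in> L2"
  using assms subspace_fibre unfolding p_sections_2_iff
  by (auto intro!: strongly_measurable_add subspace_add integrable_norm_squared_add
      borel_measurable_norm_completion)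

lemma L2_scale_bounded:
  assumes v: "v \<in> L2" and f: "f \<in> borel_measurable M" and bound: "\<And>x. \<bar>f x\<bar> \<le> K"
  shows "(\<lambda>x. f x *\<^sub>R v x) \<in> L2"
proof -
  have sm: "strongly_measurable M (\<lambda>x. f x *\<^sub>R v x)"
    using v f by (intro strongly_measurable_scaleR L2_strongly_measurable)
  have "integrable (completion M) (\<lambda>x. (norm (f x *\<^sub>R v x))\<^sup>2)"
  proof (rule Bochner_Integration.integrable_bound)
    show "integrable (completion M) (\<lambda>x. K\<^sup>2 * (norm (v x))\<^sup>2)" using L2_integrable[OF v] by simp
    have "\<bar>f x\<bar>\<^sup>2 \<le> K\<^sup>2" for x using bound by (intro power_mono) auto
    thus "AE x in completion M. norm ((norm (f x *\<^sub>R v x))\<^sup>2) \<le> norm (K\<^sup>2 * (norm (v x))\<^sup>2)"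
      by (intro AE_I2) (simp add: power_mult_distrib mult_right_mono)
  qed (use borel_measurable_norm_completion[OF sm] in measurable)
  thus ?thesis
    using sm subspace_fibre L2_in_fibre[OF v] by (simp add: p_sections_2_iff subspace_scale)
qed

lemma L2_scale: "v \<in> L2 \<Longrightarrow> (\<lambda>x. c *\<^sub>R v x) \<in> L2"
  by (rule L2_scale_bounded[of v "\<lambda>_. c" "\<bar>c\<bar>"]) auto

lemma L2_uminus: "v \<in> L2 \<Longrightarrow> (\<lambda>x. - v x) \<in> L2"
  using L2_scale[of v "-1"] by simp

lemma L2_diff: "v \<in> L2 \<Longrightarrow> w \<in> L2 \<Longrightarrow> (\<lambda>x. v x - w x) \<in> L2"
  using L2_add[OF _ L2_scale, of v w "-1"] by simp

lemma L2_zero: "(\<lambda>x. 0) \<in> L2"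
  using subspace_fibre by (auto simp: p_sections_2_iff strongly_measurable_zero subspace_0)

lemma l2_norm_AE_eq:
  assumes "v \<in> L2" "w \<in> L2" "AE x in M. v x = w x"
  shows "l2_norm M v = l2_norm M w"
proof -
  have "AE x in completion M. (norm (v x))\<^sup>2 = (norm (w x))\<^sup>2"
    using assms(3) by (intro AE_completion) auto
  thus ?thesis
    unfolding l2_norm_def using assms(1,2)[THEN L2_norm_measurable]
    by (intro arg_cong[of _ _ sqrt] integral_cong_AE) auto
qed

lemma l2_norm_eq_0_iff: "v \<in> L2 \<Longrightarrow> l2_norm M v = 0 \<longleftrightarrow> (AE x in M. v x = 0)"
  by (simp add: l2_norm_def integral_nonneg_eq_0_iff_AE[OF L2_integrable] AE_completion_iff)

lemma l2_norm_scale: "l2_norm M (\<lambda>x. c *\<^sub>R v x) = \<bar>c\<bar> * l2_norm M v"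
  by (simp add: l2_norm_def power_mult_distrib real_sqrt_mult)

text \<open>
  Writing \<open>a\<close> and \<open>b\<close> for the two norms, the weighted inequality
  \<open>(s + t)\<^sup>2 \<le> (1 + b / a) s\<^sup>2 + (1 + a / b) t\<^sup>2\<close> integrates exactly to \<open>(a + b)\<^sup>2\<close>. The weights
  are undefined only when one of the sections vanishes almost everywhere.
\<close>

lemma l2_norm_triangle:
  assumes v: "v \<in> L2" and w: "w \<in> L2"
  shows "l2_norm M (\<lambda>x. v x + w x) \<le> l2_norm M v + l2_norm M w"
proof -
  define a b where "a = l2_norm M v" and "b = l2_norm M w"
  have nonneg: "0 \<le> a" "0 \<le> b" by (simp_all add: a_def b_def l2_norm_nonneg)
  consider "a = 0" | "b = 0" | "0 < a" "0 < b" using nonneg by fastforce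
  thus ?thesis
  proof cases
    case 1
    hence "AE x in M. v x = 0" using l2_norm_eq_0_iff[OF v] by (simp add: a_def)
    hence "l2_norm M (\<lambda>x. v x + w x) = l2_norm M w"
      by (intro l2_norm_AE_eq L2_add v w) auto
    thus ?thesis using nonneg by (simp add: a_def)
  next
    case 2
    hence "AE x in M. w x = 0" using l2_norm_eq_0_iff[OF w] by (simp add: b_def)
    hence "l2_norm M (\<lambda>x. v x + w x) = l2_norm M v"
      by (intro l2_norm_AE_eq L2_add v w) auto
    thus ?thesis using nonneg by (simp add: b_def)
  next
    case 3
    have pointwise: "(norm (v x + w x))\<^sup>2 \<le> (1 + b / a) * (norm (v x))\<^sup>2 + (1 + a / b) * (norm (w x))\<^sup>2" for x
    proof -
      let ?s = "norm (v x)" and ?t = "norm (w x)"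
      have "(norm (v x + w x))\<^sup>2 \<le> (?s + ?t)\<^sup>2" by (intro power_mono norm_triangle_ineq) simp
      moreover have "(1 + b / a) * ?s\<^sup>2 + (1 + a / b) * ?t\<^sup>2 - (?s + ?t)\<^sup>2 = (b * ?s - a * ?t)\<^sup>2 / (a * b)"
        using 3 by (simp add: field_simps power2_eq_square)
      moreover have "0 \<le> (b * ?s - a * ?t)\<^sup>2 / (a * b)" using 3 by simp
      ultimately show ?thesis by linarith
    qed
    have "(l2_norm M (\<lambda>x. v x + w x))\<^sup>2
        \<le> (\<integral>x. (1 + b / a) * (norm (v x))\<^sup>2 + (1 + a / b) * (norm (w x))\<^sup>2 \<partial>completion M)"
      unfolding l2_norm_squared using pointwise L2_integrable[OF v] L2_integrable[OF w]
      by (intro integral_mono L2_integrable L2_add v w) auto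
    also have "\<dots> = (1 + b / a) * a\<^sup>2 + (1 + a / b) * b\<^sup>2"
      using L2_integrable[OF v] L2_integrable[OF w] by (simp add: a_def b_def l2_norm_squared)
    also have "\<dots> = (a + b)\<^sup>2"
    proof -
      have "b / a * a\<^sup>2 = a * b" "a / b * b\<^sup>2 = a * b" using 3 by (simp_all add: power2_eq_square)
      thus ?thesis by (simp add: distrib_right power2_sum)
    qed
    finally have "l2_norm M (\<lambda>x. v x + w x) \<le> a + b"
      by (rule power2_le_imp_le) (use nonneg in simp)
    thus ?thesis by (simp only: a_def b_def)
  qed
qed

subsection \<open>Completeness\<close>

text \<open>
  The function \<open>\<Sum>k. 4^k * (norm (s (Suc k) x - s k x))\<^sup>2\<close> has an integral bounded by
  \<open>\<Sum>k. 4^k * (1/8)^k\<close>, so it is finite almost everywhere. Where it is finite, the increments of the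
  sequence are dominated by a geometric series of ratio \<open>1/2\<close>.
\<close>

lemma L2_fast_Cauchy_AE_convergent:
  assumes s: "\<And>k. s k \<in> L2" and fast: "\<And>k. (l2_norm M (\<lambda>x. s (Suc k) x - s k x))\<^sup>2 \<le> (1/8)^k"
  shows "AE x in M. convergent (\<lambda>k. s k x)"
proof -
  define d where "d = (\<lambda>k x. (norm (s (Suc k) x - s k x))\<^sup>2)"
  have d: "integrable (completion M) (d k)" for k
    unfolding d_def by (intro L2_integrable L2_diff s)
  have meas: "(\<lambda>x. ennreal (4^k * d k x)) \<in> borel_measurable (completion M)" for k
    using borel_measurable_integrable[OF d] by measurable
  have bound: "(\<integral>\<^sup>+x. ennreal (4^k * d k x) \<partial>completion M) \<le> ennreal ((1/2)^k)" for k
  proof -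
    have "(\<integral>\<^sup>+x. ennreal (4^k * d k x) \<partial>completion M) = ennreal (4^k * (\<integral>x. d k x \<partial>completion M))"
      using d[of k] by (subst nn_integral_eq_integral) (auto simp: d_def)
    also have "4^k * (\<integral>x. d k x \<partial>completion M) \<le> 4^k * (1/8)^k"
      using fast[of k] by (intro mult_left_mono) (auto simp: l2_norm_squared d_def)
    also have "4^k * (1/8)^k = (1/2::real)^k" by (simp flip: power_mult_distrib)
    finally show ?thesis by (simp add: ennreal_leI)
  qed
  have "(\<integral>\<^sup>+x. (\<Sum>k. ennreal (4^k * d k x)) \<partial>completion M) = (\<Sum>k. \<integral>\<^sup>+x. ennreal (4^k * d k x) \<partial>completion M)"
    by (rule nn_integral_suminf[OF meas])
  also have "\<dots> \<le> (\<Sum>k. ennreal ((1/2)^k))"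
    by (intro suminf_le bound) auto
  also have "\<dots> = ennreal (\<Sum>k. (1/2)^k)"
    by (intro suminf_ennreal2) (auto intro: summable_geometric)
  also have "\<dots> < \<infinity>" by simp
  finally have "AE x in completion M. (\<Sum>k. ennreal (4^k * d k x)) \<noteq> \<infinity>"
    by (intro nn_integral_PInf_AE borel_measurable_suminf_order meas) auto
  hence "AE x in M. (\<Sum>k. ennreal (4^k * d k x)) \<noteq> \<infinity>"
    by (simp add: AE_completion_iff)
  thus ?thesis
  proof (rule AE_mp, intro AE_I2 impI)
    fix x assume "(\<Sum>k. ennreal (4^k * d k x)) \<noteq> \<infinity>"
    hence sum: "summable (\<lambda>k. 4^k * d k x)"
      by (intro summable_suminf_not_top) (auto simp: d_def)
    define C where "C = (\<Sum>k. 4^k * d k x)"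
    have geometric: "norm (s (Suc k) x - s k x) \<le> sqrt C * (1/2)^k" for k
    proof -
      have "4^k * d k x \<le> C"
        unfolding C_def using sum_le_suminf[OF sum, of "{k}"] by (simp add: d_def)
      hence "sqrt (4^k * d k x) \<le> sqrt C" by simp
      hence "2^k * norm (s (Suc k) x - s k x) \<le> sqrt C"
        by (simp add: d_def real_sqrt_mult real_sqrt_power)
      thus ?thesis by (simp add: field_simps power_one_over)
    qed
    have "summable (\<lambda>k. sqrt C * (1/2)^k)"
      by (intro summable_mult summable_geometric) simp
    hence "summable (\<lambda>k. s (Suc k) x - s k x)"
      by (rule summable_comparison_test'[where N = 0]) (rule geometric)
    hence "(\<lambda>n. \<Sum>k<n. s (Suc k) x - s k x) \<longlonglongrightarrow> (\<Sum>k. s (Suc k) x - s k x)"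
      by (rule summable_LIMSEQ)
    hence "(\<lambda>n. s n x - s 0 x) \<longlonglongrightarrow> (\<Sum>k. s (Suc k) x - s k x)"
      using sum_lessThan_telescope[of "\<lambda>k. s k x"] by simp
    hence "(\<lambda>n. s n x - s 0 x + s 0 x) \<longlonglongrightarrow> (\<Sum>k. s (Suc k) x - s k x) + s 0 x"
      by (intro tendsto_add tendsto_const)
    thus "convergent (\<lambda>k. s k x)" by (auto simp: convergent_def)
  qed
qed

text \<open>
  The value 0 on the exceptional set makes the composition with a functional a pointwise limit of
  measurable functions on the whole space, for the original measure and not only for its completion.
\<close>

lemma strongly_measurable_AE_limit:
  assumes s: "\<And>k. strongly_measurable M (s k)" and N: "N \<in> null_sets M"
    and lim: "\<And>x. x \<in> space M - N \<Longrightarrow> (\<lambda>k. s k x) \<longlonglongrightarrow> l x" and zero: "\<And>x. x \<in> N \<Longrightarrow> l x = 0"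
  shows "strongly_measurable M (l :: 'a \<Rightarrow> 'b)"
proof -
  have "\<exists>N D. N \<in> null_sets M \<and> countable D \<and> (\<forall>x\<in>space M - N. s k x \<in> closure D)" for k
    using strongly_measurableE[OF s[of k]] by metis
  then obtain N' D where N': "\<And>k. N' k \<in> null_sets M" "\<And>k. countable (D k)"
    "\<And>k x. x \<in> space M - N' k \<Longrightarrow> s k x \<in> closure (D k)"
    by metis
  show ?thesis
  proof (rule strongly_measurableI)
    fix \<omega> :: "'b \<Rightarrow> real" assume \<omega>: "bounded_linear \<omega>"
    have "(\<lambda>x. indicator (space M - N) x * \<omega> (s k x)) \<in> borel_measurable M" for k
      using strongly_measurableD[OF s \<omega>] N by auto
    moreover have "(\<lambda>k. indicator (space M - N) x * \<omega> (s k x)) \<longlonglongrightarrow> \<omega> (l x)" if "x \<in> space M" for x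
    proof (cases "x \<in> N")
      case True
      thus ?thesis using zero \<omega> by (simp add: linear_simps)
    next
      case False
      thus ?thesis using that bounded_linear.tendsto[OF \<omega> lim[of x]] by simp
    qed
    ultimately show "(\<lambda>x. \<omega> (l x)) \<in> borel_measurable M" by (rule borel_measurable_LIMSEQ_real[rotated])
  next
    show "N \<union> (\<Union>k. N' k) \<in> null_sets M" using N N'(1) by auto
    show "countable (\<Union>k. D k)" using N'(2) by auto
    fix x assume x: "x \<in> space M" "x \<notin> N \<union> (\<Union>k. N' k)"
    have "s k x \<in> closure (\<Union>k. D k)" for k
      using N'(3)[of x k] x closure_mono[of "D k" "\<Union>k. D k"] by blast
    thus "l x \<in> closure (\<Union>k. D k)"
      using closed_sequentially[OF closed_closure _ lim[of x]] x by blast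
  qed
qed

text \<open>
  Riesz--Fischer: a fast subsequence converges almost everywhere, its limit has values in the fibres
  because these are closed, and Fatou's lemma bounds the distance of each late member of the sequence
  from the limit by its distances from the later members of the subsequence.
\<close>

lemma L2_complete:
  assumes s: "\<And>n :: nat. s n \<in> L2"
    and Cauchy: "\<And>e. 0 < e \<Longrightarrow> \<exists>k. \<forall>m\<ge>k. \<forall>n\<ge>k. l2_norm M (\<lambda>x. s m x - s n x) < e"
  shows "\<exists>l\<in>L2. \<forall>e>0. \<exists>k. \<forall>n\<ge>k. l2_norm M (\<lambda>x. s n x - l x) < e"
proof -
  have "\<forall>j. \<exists>k. \<forall>m\<ge>k. \<forall>n\<ge>k. l2_norm M (\<lambda>x. s m x - s n x) < sqrt ((1/8)^j)"
    using Cauchy by simp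
  then obtain K where K: "\<And>j m n. K j \<le> m \<Longrightarrow> K j \<le> n \<Longrightarrow> l2_norm M (\<lambda>x. s m x - s n x) < sqrt ((1/8)^j)"
    by metis
  \<comment> \<open>The partial sums dominate \<open>K\<close>, and the summand \<open>k\<close> makes the subsequence strictly increasing.\<close>
  define r where "r k = (\<Sum>j\<le>k. K j) + k" for k
  have r: "strict_mono r" by (simp add: strict_mono_Suc_iff r_def)
  have Kr: "K k \<le> r k" for k using member_le_sum[of k "{..k}" K] by (simp add: r_def)
  have fast: "(l2_norm M (\<lambda>x. s (r (Suc k)) x - s (r k) x))\<^sup>2 \<le> (1/8)^k" for k
  proof -
    have "K k \<le> r (Suc k)" using Kr[of k] strict_monoD[OF r, of k "Suc k"] by simp
    hence "l2_norm M (\<lambda>x. s (r (Suc k)) x - s (r k) x) < sqrt ((1/8)^k)" by (intro K Kr)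
    hence "(l2_norm M (\<lambda>x. s (r (Suc k)) x - s (r k) x))\<^sup>2 \<le> (sqrt ((1/8)^k))\<^sup>2"
      by (intro power_mono l2_norm_nonneg) simp
    thus ?thesis by simp
  qed
  obtain N where N: "N \<in> null_sets M" "{x \<in> space M. \<not> convergent (\<lambda>k. s (r k) x)} \<subseteq> N"
    using L2_fast_Cauchy_AE_convergent[of "\<lambda>k. s (r k)", OF s fast] unfolding eventually_ae_filter by blast
  define l where "l x = (if x \<in> N then 0 else lim (\<lambda>k. s (r k) x))" for x
  have lim: "(\<lambda>k. s (r k) x) \<longlonglongrightarrow> l x" if "x \<in> space M - N" for x
    using N(2) that by (auto simp: l_def convergent_LIMSEQ_iff)
  have sm: "strongly_measurable M l"
    using lim by (rule strongly_measurable_AE_limit[OF L2_strongly_measurable[OF s] N(1)]) (auto simp: l_def)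
  have fibre: "l x \<in> E x" if "x \<in> space M" for x
  proof (cases "x \<in> N")
    case True
    thus ?thesis using subspace_fibre[OF that] by (simp add: l_def subspace_0)
  next
    case False
    thus ?thesis
      using closed_sequentially[OF closed_fibre[OF that] _ lim[of x]] L2_in_fibre[OF s that] that by blast
  qed
  have notN: "AE x in completion M. x \<in> space M - N"
    using AE_not_in[OF N(1)] by (intro AE_completion) (auto intro: AE_mp[OF _ AE_I2])
  have bound: "(\<integral>\<^sup>+x. ennreal ((norm (s n x - l x))\<^sup>2) \<partial>completion M) \<le> ennreal (e\<^sup>2)"
    if e: "0 < e" and k: "\<forall>m\<ge>k. \<forall>n\<ge>k. l2_norm M (\<lambda>x. s m x - s n x) < e" and n: "k \<le> n" for e k n
  proof -
    let ?f = "\<lambda>j x. ennreal ((norm (s n x - s (r j) x))\<^sup>2)"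
    have "(\<integral>\<^sup>+x. ennreal ((norm (s n x - l x))\<^sup>2) \<partial>completion M) = (\<integral>\<^sup>+x. liminf (\<lambda>j. ?f j x) \<partial>completion M)"
      using notN
    proof (intro nn_integral_cong_AE, elim AE_mp, intro AE_I2 impI)
      fix x assume "x \<in> space M - N"
      from lim[OF this] have "(\<lambda>j. ?f j x) \<longlonglongrightarrow> ennreal ((norm (s n x - l x))\<^sup>2)"
        by (intro tendsto_intros)
      thus "ennreal ((norm (s n x - l x))\<^sup>2) = liminf (\<lambda>j. ?f j x)"
        by (intro lim_imp_Liminf[symmetric] trivial_limit_sequentially)
    qed
    also have "\<dots> \<le> liminf (\<lambda>j. \<integral>\<^sup>+x. ?f j x \<partial>completion M)"
      using L2_norm_measurable[OF L2_diff[OF s s]] by (intro nn_integral_liminf) simp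
    also have "\<dots> \<le> ennreal (e\<^sup>2)"
    proof (intro Liminf_le)
      show "\<forall>\<^sub>F j in sequentially. (\<integral>\<^sup>+x. ?f j x \<partial>completion M) \<le> ennreal (e\<^sup>2)"
        using eventually_ge_at_top[of k]
      proof eventually_elim
        case (elim j)
        have "k \<le> r j" using seq_suble[OF r, of j] elim by simp
        hence "(l2_norm M (\<lambda>x. s n x - s (r j) x))\<^sup>2 \<le> e\<^sup>2"
          using k n by (intro power_mono l2_norm_nonneg less_imp_le) auto
        thus ?case
          by (subst nn_integral_eq_integral)
            (auto intro!: L2_integrable L2_diff s ennreal_leI simp: l2_norm_squared)
      qed
    qed simp
    finally show ?thesis .
  qed
  have diff: "(\<lambda>x. s n x - l x) \<in> L2"
    if e: "0 < e" and k: "\<forall>m\<ge>k. \<forall>n\<ge>k. l2_norm M (\<lambda>x. s m x - s n x) < e" and n: "k \<le> n" for e k n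
  proof -
    have sm': "strongly_measurable M (\<lambda>x. s n x - l x)"
      using strongly_measurable_linear_combination[OF L2_strongly_measurable[OF s[of n]] sm, of "\<lambda>_. 1" "\<lambda>_. -1"]
      by simp
    moreover have "integrable (completion M) (\<lambda>x. (norm (s n x - l x))\<^sup>2)"
      using bound[OF that] borel_measurable_norm_completion[OF sm']
      by (intro integrableI_bounded) (auto intro: le_less_trans)
    ultimately show ?thesis
      using fibre L2_in_fibre[OF s] subspace_fibre by (simp add: p_sections_2_iff subspace_diff)
  qed
  \<comment> \<open>The limit is square-integrable because it differs from a member of the sequence by a
    square-integrable section.\<close>
  obtain k1 where k1: "\<forall>m\<ge>k1. \<forall>n\<ge>k1. l2_norm M (\<lambda>x. s m x - s n x) < 1" using Cauchy[of 1] by auto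
  have "l \<in> L2" using L2_diff[OF s[of k1] diff[OF _ k1 order_refl]] by simp
  moreover have "\<exists>k. \<forall>n\<ge>k. l2_norm M (\<lambda>x. s n x - l x) < e" if "0 < e" for e
  proof -
    obtain k where k: "\<forall>m\<ge>k. \<forall>n\<ge>k. l2_norm M (\<lambda>x. s m x - s n x) < e / 2"
      using Cauchy[of "e/2"] \<open>0 < e\<close> by auto
    have "l2_norm M (\<lambda>x. s n x - l x) < e" if n: "k \<le> n" for n
    proof -
      have e: "0 < e / 2" using \<open>0 < e\<close> by simp
      have "ennreal ((l2_norm M (\<lambda>x. s n x - l x))\<^sup>2) \<le> ennreal ((e/2)\<^sup>2)"
        using bound[OF e k n] nn_integral_eq_integral[OF L2_integrable[OF diff[OF e k n]]]
        by (simp add: l2_norm_squared)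
      hence "(l2_norm M (\<lambda>x. s n x - l x))\<^sup>2 \<le> (e/2)\<^sup>2" by (subst (asm) ennreal_le_iff) auto
      hence "l2_norm M (\<lambda>x. s n x - l x) \<le> e / 2" by (rule power2_le_imp_le) (use e in simp)
      thus ?thesis using \<open>0 < e\<close> by simp
    qed
    thus ?thesis by blast
  qed
  ultimately show ?thesis by blast
qed

end

section \<open>The space of classes of sections\<close>

context closed_subspace_family
begin

abbreviation \<Gamma> :: "('a \<Rightarrow> 'b) set normed_structure" where "\<Gamma> \<equiv> section_space 2 M E"

definition ae_class :: "('a \<Rightarrow> 'b) \<Rightarrow> ('a \<Rightarrow> 'b) set" where
  "ae_class v = ae_eq 2 M E `` {v}"

lemma equiv_ae_eq: "equiv L2 (ae_eq 2 M E)"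
proof (rule equivI)
  show "ae_eq 2 M E \<subseteq> L2 \<times> L2" by (auto simp: ae_eq_def)
  show "refl_on L2 (ae_eq 2 M E)" by (auto simp: refl_on_def ae_eq_def)
  show "sym (ae_eq 2 M E)" by (auto simp: sym_def ae_eq_def eq_commute)
  show "trans (ae_eq 2 M E)" by (auto simp: trans_def ae_eq_def elim: AE_mp)
qed

lemma ae_class_eq_iff: "v \<in> L2 \<Longrightarrow> w \<in> L2 \<Longrightarrow> ae_class v = ae_class w \<longleftrightarrow> (AE x in M. v x = w x)"
  unfolding ae_class_def by (subst eq_equiv_class_iff[OF equiv_ae_eq]) (auto simp: ae_eq_def)

lemma carr_section_space: "carr \<Gamma> = ae_class ` L2"
  by (auto simp: section_space_def ae_class_def quotient_def)

lemma zero_section_space: "zero \<Gamma> = ae_class (\<lambda>x. 0)"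
  by (simp add: section_space_def ae_class_def)

lemma add_section_space:
  assumes "v \<in> L2" "w \<in> L2"
  shows "add \<Gamma> (ae_class v) (ae_class w) = ae_class (\<lambda>x. v x + w x)"
proof -
  have "congruent2 (ae_eq 2 M E) (ae_eq 2 M E) (\<lambda>v w. ae_class (\<lambda>x. v x + w x))"
    by (rule congruent2I') (auto simp: ae_eq_def ae_class_eq_iff L2_add)
  from UN_equiv_class2[OF equiv_ae_eq equiv_ae_eq this assms] show ?thesis
    by (simp add: section_space_def ae_class_def)
qed

lemma scale_section_space:
  assumes "v \<in> L2"
  shows "scale \<Gamma> c (ae_class v) = ae_class (\<lambda>x. c *\<^sub>R v x)"
proof -
  have "congruent (ae_eq 2 M E) (\<lambda>v. ae_class (\<lambda>x. c *\<^sub>R v x))"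
    by (rule congruentI) (auto simp: ae_eq_def ae_class_eq_iff L2_scale)
  from UN_equiv_class[OF equiv_ae_eq this assms] show ?thesis
    by (simp add: section_space_def ae_class_def)
qed

lemma nrm_section_space:
  assumes v: "v \<in> L2"
  shows "nrm \<Gamma> (ae_class v) = l2_norm M v"
proof -
  have "enn2real (norm_powr_integral 2 M w) powr (1 / 2) = l2_norm M v" if "w \<in> ae_class v" for w
  proof -
    have w: "w \<in> L2" "AE x in M. v x = w x" using that by (auto simp: ae_class_def ae_eq_def)
    have "(\<integral>x. (norm (w x))\<^sup>2 \<partial>completion M) = enn2real (norm_powr_integral 2 M w)"
      using L2_norm_measurable[OF w(1)]
      by (subst integral_eq_nn_integral) (auto simp: norm_powr_integral_def nn_integral_completion)
    thus ?thesis
      using l2_norm_AE_eq[OF v w] by (simp add: l2_norm_def powr_half_sqrt)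
  qed
  moreover have "v \<in> ae_class v" using v by (simp add: ae_class_def ae_eq_def)
  ultimately have "(\<lambda>w. enn2real (norm_powr_integral 2 M w) powr (1 / 2)) ` ae_class v = {l2_norm M v}"
    by (auto simp: image_iff)
  thus ?thesis by (simp add: section_space_def)
qed

lemmas section_space_simps =
  add_section_space scale_section_space nrm_section_space L2_add L2_scale L2_zero L2_uminus

lemma normed_space_on_section_space: "normed_space_on \<Gamma>"
proof -
  have "l2_norm M v = 0 \<longleftrightarrow> ae_class v = ae_class (\<lambda>x. 0)" if "v \<in> L2" for v
    using that by (simp add: l2_norm_eq_0_iff ae_class_eq_iff L2_zero)
  thus ?thesis
    by (unfold_locales; unfold carr_section_space zero_section_space)
      (auto simp: section_space_simps l2_norm_nonneg l2_norm_scale l2_norm_triangle algebra_simps)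
qed

lemma banach_space_on_section_space: "banach_space_on \<Gamma>"
proof (rule normed_space_on.banach_space_onI[OF normed_space_on_section_space])
  fix \<sigma> :: "nat \<Rightarrow> ('a \<Rightarrow> 'b) set"
  assume \<sigma>: "\<And>n. \<sigma> n \<in> carr \<Gamma>"
    and Cauchy: "\<And>e. 0 < e \<Longrightarrow> \<exists>k. \<forall>m\<ge>k. \<forall>n\<ge>k. nrm \<Gamma> (add \<Gamma> (\<sigma> m) (scale \<Gamma> (-1) (\<sigma> n))) < e"
  have "\<forall>n. \<exists>v. v \<in> L2 \<and> \<sigma> n = ae_class v" using \<sigma> unfolding carr_section_space by blast
  then obtain s where s: "\<And>n. s n \<in> L2" "\<And>n. \<sigma> n = ae_class (s n)" by metis
  have nrm: "nrm \<Gamma> (add \<Gamma> (ae_class v) (scale \<Gamma> (-1) (ae_class w))) = l2_norm M (\<lambda>x. v x - w x)"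
    if "v \<in> L2" "w \<in> L2" for v w
    using that L2_scale[of w "-1"] L2_add[of v "\<lambda>x. -1 *\<^sub>R w x"] by (simp add: section_space_simps)
  have "\<exists>l\<in>L2. \<forall>e>0. \<exists>k. \<forall>n\<ge>k. l2_norm M (\<lambda>x. s n x - l x) < e"
    using Cauchy by (intro L2_complete s) (simp add: s nrm)
  thus "\<exists>l\<in>carr \<Gamma>. \<forall>e>0. \<exists>k. \<forall>n\<ge>k. nrm \<Gamma> (add \<Gamma> (\<sigma> n) (scale \<Gamma> (-1) l)) < e"
    by (auto simp: carr_section_space s nrm)
qed

lemma integrable_polarization:
  assumes "v \<in> L2" "w \<in> L2"
  shows "integrable (completion M) (\<lambda>x. polarization (v x) (w x))"
  using L2_integrable[OF L2_add[OF assms]] L2_integrable[OF L2_diff[OF assms]]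
  by (simp add: polarization_def)

lemma polar_section_space:
  assumes v: "v \<in> L2" and w: "w \<in> L2"
  shows "polar \<Gamma> (ae_class v) (ae_class w) = (\<integral>x. polarization (v x) (w x) \<partial>completion M)"
  using L2_integrable[OF L2_add[OF assms]] L2_integrable[OF L2_diff[OF assms]]
    L2_scale[OF w, of "-1"] L2_diff[OF assms] assms
  by (simp add: polar_def polarization_def section_space_simps l2_norm_squared)

lemma integrable_polarization_defect:
  assumes "u \<in> L2" "v \<in> L2" "w \<in> L2"
  shows "integrable (completion M) (\<lambda>x. polarization_defect c (u x) (v x) (w x))"
  using integrable_polarization[OF L2_add[OF L2_scale[OF assms(1), of c] assms(2)] assms(3)]
    integrable_polarization[OF assms(1,3)] integrable_polarization[OF assms(2,3)]
  by (simp add: polarization_defect_def)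

text \<open>
  The squared norm of a class is the integral of the squared pointwise norms, so the polarization of
  two classes is the integral of the pointwise polarizations.
\<close>

theorem hilbert_section_space_iff:
  "hilbert_space_on \<Gamma> \<longleftrightarrow> (\<forall>c. \<forall>u\<in>L2. \<forall>v\<in>L2. \<forall>w\<in>L2.
     (\<integral>x. polarization_defect c (u x) (v x) (w x) \<partial>completion M) = 0)"
proof -
  have "polar \<Gamma> (add \<Gamma> (scale \<Gamma> c (ae_class u)) (ae_class v)) (ae_class w)
      = c * polar \<Gamma> (ae_class u) (ae_class w) + polar \<Gamma> (ae_class v) (ae_class w) \<longleftrightarrow>
    (\<integral>x. polarization_defect c (u x) (v x) (w x) \<partial>completion M) = 0"
    if "u \<in> L2" "v \<in> L2" "w \<in> L2" for c u v w
    using that integrable_polarization[OF L2_add[OF L2_scale[OF that(1), of c] that(2)] that(3)]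
      integrable_polarization[OF that(1,3)] integrable_polarization[OF that(2,3)]
    by (simp add: section_space_simps polar_section_space polarization_defect_def)
  thus ?thesis
    unfolding hilbert_space_on_iff_polar carr_section_space by (simp add: banach_space_on_section_space)
qed

text \<open>
  Multiplication of the three sections by an indicator multiplies their defect by it, as the defect
  vanishes at the zero vectors. So the integral of the defect over every measurable set is zero. The
  defect itself is measurable only for the completed measure and is replaced by a measurable
  representative first.
\<close>

lemma polarization_defect_localize:
  assumes M: "sigma_finite_measure M" and hilbert: "hilbert_space_on \<Gamma>"
    and L2: "u \<in> L2" "v \<in> L2" "w \<in> L2"
  shows "AE x in M. polarization_defect c (u x) (v x) (w x) = 0"
proof -
  define F where "F = (\<lambda>x. polarization_defect c (u x) (v x) (w x))"
  have F: "integrable (completion M) F"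
    unfolding F_def by (intro integrable_polarization_defect L2)
  then obtain F' where F': "F' \<in> borel_measurable M" "AE x in M. F x = F' x"
    using completion_ex_borel_measurable_real[OF borel_measurable_integrable[OF F]] by blast
  have ae: "AE x in completion M. F x = F' x" using F'(2) by (rule AE_completion)
  have F'c: "F' \<in> borel_measurable (completion M)" using F'(1) by (rule measurable_completion)
  have "integrable (completion M) F'" by (rule integrable_cong_AE_imp[OF F F'c ae])
  hence F'_int: "integrable M F'" using integrable_completion[OF F'(1)] by simp
  have "set_lebesgue_integral M A F' = 0" if A: "A \<in> sets M" for A
  proof -
    have ind: "(\<lambda>x. indicator A x *\<^sub>R f x) \<in> L2" if "f \<in> L2" for f
      by (rule L2_scale_bounded[OF that, of _ 1]) (use A in \<open>auto simp: indicator_def\<close>)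
    have "set_lebesgue_integral M A F' = (\<integral>x. indicator A x *\<^sub>R F' x \<partial>completion M)"
      unfolding set_lebesgue_integral_def using F'(1) A
      by (intro integral_completion[symmetric] borel_measurable_scaleR borel_measurable_indicator)
    also have "\<dots> = (\<integral>x. indicator A x *\<^sub>R F x \<partial>completion M)"
      using ae borel_measurable_integrable[OF F] F'c A
      by (intro integral_cong_AE borel_measurable_scaleR borel_measurable_indicator) auto
    also have "\<dots> = (\<integral>x. polarization_defect c (indicator A x *\<^sub>R u x) (indicator A x *\<^sub>R v x) (indicator A x *\<^sub>R w x) \<partial>completion M)"
      by (intro Bochner_Integration.integral_cong refl)
        (simp add: F_def polarization_defect_def polarization_def indicator_def)
    also have "\<dots> = 0"
      by (rule hilbert_section_space_iff[THEN iffD1, OF hilbert, rule_format,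
            OF ind[OF L2(1)] ind[OF L2(2)] ind[OF L2(3)]])
    finally show ?thesis .
  qed
  hence "AE x in M. F' x = 0" by (intro sigma_finite_measure.density_zero[OF M F'_int])
  thus ?thesis using F'(2) unfolding F_def by (auto elim: AE_mp)
qed

text \<open>
  On a Hilbert fibre the defect of any three vectors is zero, so the integrand vanishes almost everywhere.
\<close>

theorem hilbert_bundle_imp_hilbert_section_space:
  assumes "hilbert_bundle M E"
  shows "hilbert_space_on \<Gamma>"
  unfolding hilbert_section_space_iff
proof (intro allI ballI integral_eq_zero_AE AE_completion)
  fix c u v w assume L2: "u \<in> L2" "v \<in> L2" "w \<in> L2"
  show "AE x in M. polarization_defect c (u x) (v x) (w x) = 0"
    using assms unfolding hilbert_bundle_def
    by (rule AE_mp)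
      (auto intro!: AE_I2 simp: hilbert_space_on_subspace_structure_iff subspace_fibre closed_fibre L2_in_fibre L2)
qed

end

section \<open>Measurable selections\<close>

text \<open>
  The distance of \<open>y\<close> from \<open>E x\<close> is less than \<open>a\<close> exactly if \<open>E x\<close> meets the open ball of radius \<open>a\<close>
  about \<open>y\<close>, which is a condition of the kind that weak measurability controls.
\<close>

lemma weakly_measurable_infdist:
  fixes E :: "'a \<Rightarrow> 'b::metric_space set"
  assumes E: "weakly_measurable M E" and ne: "\<And>x. x \<in> space M \<Longrightarrow> E x \<noteq> {}"
  shows "(\<lambda>x. infdist y (E x)) \<in> borel_measurable M"
proof (rule borel_measurableI_less)
  fix a :: real
  have "infdist y (E x) < a \<longleftrightarrow> E x \<inter> ball y a \<noteq> {}" if "x \<in> space M" for x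
  proof
    assume "infdist y (E x) < a"
    hence "\<exists>z\<in>E x. dist y z < a"
      using ne[OF that] by (simp add: infdist_def cINF_less_iff)
    thus "E x \<inter> ball y a \<noteq> {}" by auto
  next
    assume "E x \<inter> ball y a \<noteq> {}"
    then obtain z where "z \<in> E x" "dist y z < a" by auto
    thus "infdist y (E x) < a" using infdist_le le_less_trans by blast
  qed
  hence "{x \<in> space M. infdist y (E x) < a} = {x \<in> space M. E x \<inter> ball y a \<noteq> {}}" by auto
  thus "{x \<in> space M. infdist y (E x) < a} \<in> sets M"
    using E unfolding weakly_measurable_def by simp
qed

text \<open>
  The Kuratowski--Ryll-Nardzewski construction. Starting from \<open>d i\<close>, each step moves to the first
  point of the dense sequence that is hardly farther away than the fibre and is itself much closer to
  the fibre. The steps decrease geometrically, so the points converge to a point of the fibre, and the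
  first step has length at most \<open>infdist (d i) (E x) + e\<close> and the later ones add up to at most \<open>2 * e\<close>. Choosing the first admissible index
  makes every step measurable.
\<close>

lemma measurable_selection_near:
  fixes E :: "'a \<Rightarrow> 'b::complete_space set"
  assumes E: "weakly_measurable M E"
    and ne: "\<And>x. x \<in> space M \<Longrightarrow> E x \<noteq> {}" and closed: "\<And>x. x \<in> space M \<Longrightarrow> closed (E x)"
    and dense: "closure (range (d :: nat \<Rightarrow> 'b)) = UNIV" and e: "0 < e"
  obtains v where "v \<in> borel_measurable M" "\<And>x. x \<in> space M \<Longrightarrow> v x \<in> E x"
    "\<And>x. x \<in> space M \<Longrightarrow> dist (d i) (v x) \<le> infdist (d i) (E x) + 3 * e"
proof -
  define \<epsilon> where "\<epsilon> k = e * (1/2)^k" for k :: nat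
  have \<epsilon>: "0 < \<epsilon> k" for k using e by (simp add: \<epsilon>_def)
  \<comment> \<open>\<open>n\<close> is an admissible successor of \<open>p\<close> in step \<open>k\<close>\<close>
  define good where "good k p n x \<longleftrightarrow>
    dist (d p) (d n) < infdist (d p) (E x) + \<epsilon> k \<and> infdist (d n) (E x) < \<epsilon> (Suc k)" for k p n x
  define idx where "idx = rec_nat (\<lambda>x. i) (\<lambda>k f x. LEAST n. good k (f x) n x)"
  have idx0: "idx 0 = (\<lambda>x. i)" and idx_Suc: "idx (Suc k) = (\<lambda>x. LEAST n. good k (idx k x) n x)" for k
    by (simp_all add: idx_def)
  have good_ex: "\<exists>n. good k p n x" if x: "x \<in> space M" for k p x
  proof -
    have "(INF y\<in>E x. dist (d p) y) < infdist (d p) (E x) + \<epsilon> k"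
      using \<epsilon>[of k] ne[OF x] by (simp add: infdist_def)
    then obtain y where y: "y \<in> E x" "dist (d p) y < infdist (d p) (E x) + \<epsilon> k"
      using ne[OF x] by (auto simp: cINF_less_iff)
    \<comment> \<open>Every \<open>d n\<close> within \<open>r\<close> of \<open>y\<close> is admissible.\<close>
    define r where "r = min (\<epsilon> (Suc k)) (infdist (d p) (E x) + \<epsilon> k - dist (d p) y)"
    have "0 < r" using y \<epsilon> by (simp add: r_def)
    then obtain n where n: "dist (d n) y < r"
      using dense closure_approachable[of y "range d"] by auto
    have "infdist (d n) (E x) < \<epsilon> (Suc k)"
      using infdist_le[OF y(1), of "d n"] n by (simp add: r_def)
    moreover have "dist (d p) (d n) < infdist (d p) (E x) + \<epsilon> k"
      using n dist_triangle[of "d p" "d n" y] by (simp add: r_def dist_commute)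
    ultimately show ?thesis by (auto simp: good_def)
  qed
  have good: "good k (idx k x) (idx (Suc k) x) x" if "x \<in> space M" for k x
    unfolding idx_Suc by (rule LeastI_ex[OF good_ex[OF that]])
  have idx_meas: "idx k \<in> measurable M (count_space UNIV)" for k
  proof (induction k)
    case (Suc k)
    note [measurable] = weakly_measurable_infdist[OF E ne]
    have "Measurable.pred M (good k p n)" for p n
      unfolding good_def by measurable
    hence "(\<lambda>x. LEAST n. good k p n x) \<in> measurable M (count_space UNIV)" for p
      by measurable
    thus ?case unfolding idx_Suc
      by (rule measurable_compose_countable'[where I = UNIV]) (use Suc in auto)
  qed (simp add: idx0)
  define f where "f k x = d (idx k x)" for k x
  have f_meas: "f k \<in> borel_measurable M" for k
    unfolding f_def by (rule measurable_compose[OF idx_meas]) simp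
  have step0: "dist (f 0 x) (f (Suc 0) x) < infdist (d i) (E x) + e" if "x \<in> space M" for x
    using good[OF that, of 0] by (simp add: good_def f_def idx0 \<epsilon>_def)
  have near: "infdist (f (Suc k) x) (E x) < \<epsilon> (Suc k)" if "x \<in> space M" for k x
    using good[OF that, of k] by (simp add: good_def f_def)
  have step: "dist (f (Suc k) x) (f (Suc (Suc k)) x) < 2 * \<epsilon> (Suc k)" if "x \<in> space M" for k x
    using good[OF that, of "Suc k"] near[OF that, of k] by (simp add: good_def f_def)
  \<comment> \<open>The factor \<open>1 - (1/2)^n\<close> makes the sum of the geometric series provable by induction. The
    sequence starts at \<open>Suc k\<close>, because the first step is not small.\<close>
  have tail: "dist (f (Suc k) x) (f (Suc (k + n)) x) \<le> 4 * \<epsilon> (Suc k) * (1 - (1/2)^n)" if x: "x \<in> space M" for k n x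
  proof (induction n)
    case (Suc n)
    have "dist (f (Suc k) x) (f (Suc (k + Suc n)) x)
      \<le> dist (f (Suc k) x) (f (Suc (k + n)) x) + dist (f (Suc (k + n)) x) (f (Suc (Suc (k + n))) x)"
      using dist_triangle[of "f (Suc k) x" "f (Suc (Suc (k + n))) x" "f (Suc (k + n)) x"] by simp
    also have "\<dots> \<le> 4 * \<epsilon> (Suc k) * (1 - (1/2)^n) + 2 * \<epsilon> (Suc (k + n))"
      using Suc step[OF x, of "k + n"] by simp
    also have "\<dots> = 4 * \<epsilon> (Suc k) * (1 - (1/2)^Suc n)"
      by (simp add: \<epsilon>_def power_add algebra_simps)
    finally show ?case .
  qed simp
  have tail': "dist (f (Suc k) x) (f (Suc (k + n)) x) \<le> 4 * \<epsilon> (Suc k)" if x: "x \<in> space M" for k n x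
  proof -
    have "4 * \<epsilon> (Suc k) * (1 - (1/2)^n) \<le> 4 * \<epsilon> (Suc k) * 1"
      using \<epsilon>[of "Suc k"] by (intro mult_left_mono) auto
    thus ?thesis using tail[OF x, of k n] by simp
  qed
  have \<epsilon>_lim: "(\<lambda>k. 4 * \<epsilon> (Suc k)) \<longlonglongrightarrow> 0"
    unfolding \<epsilon>_def by (intro tendsto_mult_right_zero LIMSEQ_Suc LIMSEQ_realpow_zero) auto
  have conv: "convergent (\<lambda>k. f (Suc k) x)" if x: "x \<in> space M" for x
  proof -
    have "Cauchy (\<lambda>k. f (Suc k) x)"
      unfolding Cauchy_altdef
    proof (intro allI impI)
      fix r :: real assume "0 < r"
      then obtain K where K: "\<And>k. K \<le> k \<Longrightarrow> 4 * \<epsilon> (Suc k) < r"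
        using order_tendstoD(2)[OF \<epsilon>_lim, of r] by (auto simp: eventually_sequentially)
      have "dist (f (Suc m) x) (f (Suc n) x) < r" if "K \<le> m" "m < n" for m n
        using tail'[OF x, of m "n - m"] K[OF that(1)] that by simp
      thus "\<exists>K. \<forall>m\<ge>K. \<forall>n>m. dist (f (Suc m) x) (f (Suc n) x) < r" by blast
    qed
    thus ?thesis by (rule Cauchy_convergent)
  qed
  define v where "v x = lim (\<lambda>k. f (Suc k) x)" for x
  have lim: "(\<lambda>k. f (Suc k) x) \<longlonglongrightarrow> v x" if "x \<in> space M" for x
    using conv[OF that] unfolding v_def convergent_LIMSEQ_iff .
  show ?thesis
  proof (rule that)
    show "v \<in> borel_measurable M" by (rule borel_measurable_LIMSEQ_metric[OF f_meas lim])
    fix x assume x: "x \<in> space M"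
    have "(\<lambda>k. infdist (f (Suc k) x) (E x)) \<longlonglongrightarrow> 0"
    proof (rule tendsto_sandwich[OF _ _ tendsto_const \<epsilon>_lim])
      show "\<forall>\<^sub>F k in sequentially. infdist (f (Suc k) x) (E x) \<le> 4 * \<epsilon> (Suc k)"
        using near[OF x] \<epsilon> by (intro always_eventually allI) (smt (verit))
    qed (simp add: infdist_nonneg)
    moreover have "(\<lambda>k. infdist (f (Suc k) x) (E x)) \<longlonglongrightarrow> infdist (v x) (E x)"
      by (intro tendsto_infdist lim x)
    ultimately have "infdist (v x) (E x) = 0" using LIMSEQ_unique by blast
    thus "v x \<in> E x" using in_closed_iff_infdist_zero[OF closed[OF x] ne[OF x]] by simp
    have "(\<lambda>k. dist (f (Suc 0) x) (f (Suc k) x)) \<longlonglongrightarrow> dist (f (Suc 0) x) (v x)"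
      by (intro tendsto_intros lim x)
    hence "dist (f (Suc 0) x) (v x) \<le> 4 * \<epsilon> (Suc 0)"
      using tail'[OF x, of 0] by (intro LIMSEQ_le_const2) auto
    hence "dist (f (Suc 0) x) (v x) \<le> 2 * e" by (simp add: \<epsilon>_def)
    thus "dist (d i) (v x) \<le> infdist (d i) (E x) + 3 * e"
      using step0[OF x] dist_triangle[of "d i" "v x" "f (Suc 0) x"] e by (simp add: f_def idx0)
  qed
qed

section \<open>Square-integrable sections dense in every fibre\<close>

context closed_subspace_family
begin

text \<open>
  For each point of a dense sequence and each precision there is a selection that approximates this
  point almost as well as the fibre allows, so these selections are dense in every fibre. Cutting them
  off outside sets of finite measure on which they are bounded makes them square-integrable; each \<open>x\<close>
  is eventually left untouched by the cut-off, which preserves density.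
\<close>

lemma countable_fibrewise_dense_L2:
  assumes M: "sigma_finite_measure M" and E: "weakly_measurable M E"
    and sep: "separable_space (euclidean :: 'b topology)"
  obtains S where "countable S" "S \<subseteq> L2" "\<And>x. x \<in> space M \<Longrightarrow> E x \<subseteq> closure ((\<lambda>s. s x) ` S)"
proof -
  obtain D :: "'b set" where D: "countable D" "closure D = UNIV"
    using sep unfolding separable_space_def by (metis euclidean_closure_of topspace_euclidean)
  hence "D \<noteq> {}" by auto
  define d where "d = from_nat_into D"
  have "range d = D" unfolding d_def using \<open>D \<noteq> {}\<close> D(1) by (rule range_from_nat_into)
  with D have dense: "closure (range d) = UNIV" by simp
  have ne: "E x \<noteq> {}" if "x \<in> space M" for x using subspace_0[OF subspace_fibre[OF that]] by auto
  have "\<exists>v. v \<in> borel_measurable M \<and> (\<forall>x\<in>space M. v x \<in> E x) \<and>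
      (\<forall>x\<in>space M. dist (d i) (v x) \<le> infdist (d i) (E x) + 3 * (1 / real (Suc m)))" for i m
    by (rule measurable_selection_near[OF E ne closed_fibre dense, of "1 / real (Suc m)" i]) auto
  then obtain v where v: "\<And>i m. v i m \<in> borel_measurable M" "\<And>i m x. x \<in> space M \<Longrightarrow> v i m x \<in> E x"
    "\<And>i m x. x \<in> space M \<Longrightarrow> dist (d i) (v i m x) \<le> infdist (d i) (E x) + 3 * (1 / real (Suc m))"
    by metis
  obtain A :: "nat \<Rightarrow> 'a set" where A: "range A \<subseteq> sets M" "(\<Union>k. A k) = space M"
    "\<And>k. emeasure M (A k) \<noteq> \<infinity>" "incseq A"
    using sigma_finite_measure.sigma_finite_incseq[OF M] by blast
  define B where "B i m k = A k \<inter> {x \<in> space M. norm (v i m x) \<le> real k}" for i m k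
  define t where "t i m k x = indicator (B i m k) x *\<^sub>R v i m x" for i m k x
  have B: "B i m k \<in> sets M" for i m k
  proof -
    note [measurable] = v(1)
    have [measurable]: "A k \<in> sets M" using A(1) by auto
    show ?thesis unfolding B_def by measurable
  qed
  have "t i m k \<in> L2" for i m k
  proof -
    have "strongly_measurable M (v i m)"
    proof (rule strongly_measurableI[where N = "{}" and D = "range d"])
      fix \<omega> :: "'b \<Rightarrow> real" assume "bounded_linear \<omega>"
      hence "\<omega> \<in> borel_measurable borel"
        by (intro borel_measurable_continuous_onI linear_continuous_on)
      thus "(\<lambda>x. \<omega> (v i m x)) \<in> borel_measurable M" using v(1) by measurable
    qed (use dense in auto)
    hence sm: "strongly_measurable M (t i m k)"
      unfolding t_def using B by (intro strongly_measurable_scaleR borel_measurable_indicator)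
    have "integrable (completion M) (\<lambda>x. (norm (t i m k x))\<^sup>2)"
    proof (rule integrableI_bounded_set)
      show "A k \<in> sets (completion M)" "emeasure (completion M) (A k) < \<infinity>"
        using A(1) A(3)[of k] by (auto simp: less_top)
      have "(norm (t i m k x))\<^sup>2 \<le> (real k)\<^sup>2" for x
        by (intro power_mono) (auto simp: t_def B_def indicator_def)
      thus "AE x in completion M. x \<in> A k \<longrightarrow> norm ((norm (t i m k x))\<^sup>2) \<le> (real k)\<^sup>2"
        by (intro AE_I2) simp
      show "AE x in completion M. x \<notin> A k \<longrightarrow> (norm (t i m k x))\<^sup>2 = 0"
        by (intro AE_I2) (simp add: t_def B_def)
    qed (use borel_measurable_norm_completion[OF sm] in measurable)
    thus ?thesis
      using sm v(2) subspace_fibre unfolding p_sections_2_iff by (simp add: t_def subspace_scale)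
  qed
  moreover have "E x \<subseteq> closure ((\<lambda>s. s x) ` range (\<lambda>(i, m, k). t i m k))" if x: "x \<in> space M" for x
  proof
    fix y assume y: "y \<in> E x"
    show "y \<in> closure ((\<lambda>s. s x) ` range (\<lambda>(i, m, k). t i m k))"
      unfolding closure_approachable
    proof (intro allI impI)
      fix e :: real assume e: "0 < e"
      have "\<exists>z\<in>range d. dist z y < e / 4"
        using dense e closure_approachable[of y "range d"] by (metis UNIV_I zero_less_divide_iff zero_less_numeral)
      then obtain i where i: "dist (d i) y < e / 4" by auto
      obtain m where m: "1 / real (Suc m) < e / 12" using nat_approx_posE[of "e/12"] e by auto
      obtain k0 where k0: "x \<in> A k0" using A(2) x by blast
      define k where "k = max k0 (nat \<lceil>norm (v i m x)\<rceil>)"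
      have "x \<in> A k" using k0 incseqD[OF A(4), of k0 k] by (auto simp: k_def)
      moreover have "norm (v i m x) \<le> real k"
        unfolding k_def by (meson max.cobounded2 of_nat_mono order_trans real_nat_ceiling_ge)
      ultimately have "t i m k x = v i m x" using x by (simp add: t_def B_def)
      moreover have "dist (v i m x) y < e"
        using e v(3)[OF x, of i m] infdist_le[OF y, of "d i"] i m dist_triangle3[of "v i m x" y "d i"] by linarith
      moreover have "t i m k x \<in> (\<lambda>s. s x) ` range (\<lambda>(i, m, k). t i m k)"
        by (intro imageI range_eqI[of _ _ "(i, m, k)"]) simp
      ultimately show "\<exists>z\<in>(\<lambda>s. s x) ` range (\<lambda>(i, m, k). t i m k). dist z y < e" by metis
    qed
  qed
  ultimately show ?thesis by (intro that[of "range (\<lambda>(i, m, k). t i m k)"]) auto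
qed

text \<open>
  Countably many equations hold outside a single null set. There the zero set of the defect contains
  \<open>\<rat> \<times> D \<times> D \<times> D\<close> with \<open>D\<close> dense in the fibre, and it is closed.
\<close>

theorem hilbert_section_space_imp_hilbert_bundle:
  assumes M: "sigma_finite_measure M" and E: "weakly_measurable M E"
    and sep: "separable_space (euclidean :: 'b topology)" and hilbert: "hilbert_space_on \<Gamma>"
  shows "hilbert_bundle M E"
proof -
  obtain S where S: "countable S" "S \<subseteq> L2" "\<And>x. x \<in> space M \<Longrightarrow> E x \<subseteq> closure ((\<lambda>s. s x) ` S)"
    using countable_fibrewise_dense_L2[OF M E sep] by blast
  have "AE x in M. \<forall>c\<in>\<rat>. \<forall>u\<in>S. \<forall>v\<in>S. \<forall>w\<in>S. polarization_defect c (u x) (v x) (w x) = 0"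
    using S(2) polarization_defect_localize[OF M hilbert]
    by (simp add: AE_ball_countable S(1) countable_rat) blast
  thus ?thesis
    unfolding hilbert_bundle_def
  proof (rule AE_mp, intro AE_I2 impI)
    fix x assume x: "x \<in> space M"
      and zero: "\<forall>c\<in>\<rat>. \<forall>u\<in>S. \<forall>v\<in>S. \<forall>w\<in>S. polarization_defect c (u x) (v x) (w x) = 0"
    let ?Z = "{(c, u, v, w). polarization_defect c u v w = 0} :: (real \<times> 'b \<times> 'b \<times> 'b) set"
    let ?Sx = "(\<lambda>s. s x) ` S"
    have "closed ?Z"
      unfolding polarization_defect_def polarization_def split_def
      by (intro closed_Collect_eq continuous_intros) simp_all
    moreover have "\<rat> \<times> ?Sx \<times> ?Sx \<times> ?Sx \<subseteq> ?Z" using zero by auto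
    ultimately have "closure (\<rat> \<times> ?Sx \<times> ?Sx \<times> ?Sx) \<subseteq> ?Z" by (intro closure_minimal)
    hence "UNIV \<times> E x \<times> E x \<times> E x \<subseteq> ?Z"
      using S(3)[OF x] by (force simp: closure_Times Rats_closure_real)
    hence "\<forall>c. \<forall>u\<in>E x. \<forall>v\<in>E x. \<forall>w\<in>E x. polarization_defect c u v w = 0" by blast
    thus "hilbert_space_on (subspace_structure (E x))"
      using hilbert_space_on_subspace_structure_iff[OF subspace_fibre[OF x] closed_fibre[OF x]] by simp
  qed
qed

end

theorem theorem3p1:
  fixes M :: "'a measure" and E :: "'a \<Rightarrow> 'b::banach set"
  assumes "sigma_finite_measure M" and "banach_bundle M E"
  shows "(separable_space (euclidean :: 'b topology) \<longrightarrow>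
           (hilbert_bundle M E \<longleftrightarrow> hilbert_space_on (section_space 2 M E))) \<and>
         (hilbert_bundle M E \<longrightarrow> hilbert_space_on (section_space 2 M E))"
proof -
  interpret closed_subspace_family M E
    using assms(2) by unfold_locales (auto simp: banach_bundle_def)
  have "weakly_measurable M E" using assms(2) by (simp add: banach_bundle_def)
  thus ?thesis
    using assms(1) hilbert_bundle_imp_hilbert_section_space hilbert_section_space_imp_hilbert_bundle by blast
qed

end
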